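(* Let $k\ge 1$ be an integer. There is a group isomorphism $\hat\Gamma_{2k}/{\sim}\;\cong\;\mathbb{Z}_2\times\operatorname{Cliff}(Alt(2^k))$. Moreover, for the matrix representations $\rho$ of the elements of $\hat\Gamma_{2k}$, there is a group isomorphism $\hat\Gamma_{2k}/{\sim}\;\cong\;\rho(\hat\Gamma_{2k})/\mathbb{Z}_2$, where $\rho(\hat\Gamma_{2k})/\mathbb{Z}_2$ denotes the group of matrices $\rho(e_\mu)$, $e_\mu\in\hat\Gamma_{2k}$, modulo replacement of any entries of the matrices by their negatives.
   Context: Clifford algebra: $Cl(\mathbb{C}^{2k})$ is the unital associative complex algebra generated by $e_1,\dots,e_{2k}$ with $e_j^2=-1$ and $e_je_l=-e_le_j$ for $j\neq l$. For a finite sequence $\mu=(i_1,\dots,i_l)$ in $\{1,\dots,2k\}$ put $e_\mu=e_{i_1}\cdots e_{i_l}$, with $e_\emptyset=1$. $\hat\Gamma_{2k}$ is the multiplicative group consisting of the $2^{2k}$ elements $e_\mu$ with $\mu$ strictly increasing, together with their negatives. Representation: let $E_1=\begin{pmatrix} i&0\\0&-i\end{pmatrix}$, $E_2=\begin{pmatrix}0&i\\i&0\end{pmatrix}$, $B=\begin{pmatrix}0&-i\\i&0\end{pmatrix}$, and $I_2$ the $2\times2$ identity. The algebra isomorphism $\rho:Cl(\mathbb{C}^{2k})\to \mathrm{Mat}_{2^k}(\mathbb{C})$ is determined by $\rho(e_{2j-1})=I_2^{\otimes (k-j)}\otimes E_1\otimes B^{\otimes (j-1)}$ and $\rho(e_{2j})=I_2^{\otimes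 (k-j)}\otimes E_2\otimes B^{\otimes (j-1)}$ for $1\le j\le k$, where $\otimes$ is the Kronecker product (the block matrix $M\otimes N$ has blocks $m_{ab}N$). Torus: $S_{\Delta_{2k}}=\mathbb{C}^{2^k}/(\mathbb{Z}^{2^k}\oplus i\mathbb{Z}^{2^k})$, $J_2^{S_{\Delta_{2k}}}=\{x\in S_{\Delta_{2k}}:2x=0\}$; the matrices $\rho(e_\mu)$ have entries in $\mathbb{Z}[i]$ and act on $J_2^{S_{\Delta_{2k}}}$. Equivalence on $\hat\Gamma_{2k}$: $a\sim b$ iff $\rho(a)\vec v=\rho(b)\vec v$ for all $\vec v\in J_2^{S_{\Delta_{2k}}}$. The set of classes $\hat\Gamma_{2k}/{\sim}$ is a group under $[a][b]=[ab]$. Two matrices in $\rho(\hat\Gamma_{2k})$ are identified in $\rho(\hat\Gamma_{2k})/\mathbb{Z}_2$ iff one is obtained from the other by replacing some (possibly all or none) of its entries by their negatives; the group operation is induced by matrix multiplication. Switch permutations: for $0\le j\le k-1$, divide $\{1,\dots,2^k\}$ into $2^{k-j}$ consecutive blocks of size $2^j$; $A_{2^j}$ is the permutation interchanging the first and second blocks, the third and fourth blocks, etc., preserving order within each block. $(1)$ is the identity permutation. $\operatorname{Cliff}(Alt(2^k))$ is the set of all permutations $S_k\circ\cdots\circ S_1$ of $\{1,\dots,2^k\}$ with $S_l\in\{(1),A_{2^{l-1}}\}$ for $1\le l\le k$, a group under composition. $\mathbb{Z}_2$ is the group of order 2. *)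

theory Defs
  imports
    "HOL-Algebra.QuotRing"
    "HOL-Algebra.Elementary_Groups"
    "HOL-Algebra.Sym_Groups"
    "Jordan_Normal_Form.Matrix"
begin

section \<open>The Clifford algebra\<close>

text \<open>
  The Clifford algebra is the presented algebra: the free unital associative complex algebra on
  generators \<open>1, \<dots>, n\<close> modulo the two-sided ideal generated by the Clifford relations.
  An element of the free algebra is a finitely supported function from words to coefficients.
  Since the scalars are central and the algebra is unital, ring ideals are algebra ideals.
\<close>

definition free_algebra :: "nat \<Rightarrow> (nat list \<Rightarrow> complex) ring" where
  "free_algebra n =
    \<lparr> carrier = {f. finite {w. f w \<noteq> 0} \<and> {w. f w \<noteq> 0} \<subseteq> lists {1..n}},
      monoid.mult = (\<lambda>f g w. \<Sum>i\<le>length w. f (take i w) * g (drop i w)),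
      one = (\<lambda>w. if w = [] then 1 else 0),
      zero = (\<lambda>w. 0),
      add = (\<lambda>f g w. f w + g w) \<rparr>"

definition word :: "nat list \<Rightarrow> nat list \<Rightarrow> complex" where
  "word w = (\<lambda>u. if u = w then 1 else 0)"

definition clifford_relations :: "nat \<Rightarrow> (nat list \<Rightarrow> complex) set" where
  "clifford_relations n =
     {word [j, j] \<oplus>\<^bsub>free_algebra n\<^esub> \<one>\<^bsub>free_algebra n\<^esub> | j. j \<in> {1..n}} \<union>
     {word [j, l] \<oplus>\<^bsub>free_algebra n\<^esub> word [l, j] | j l. j \<in> {1..n} \<and> l \<in> {1..n} \<and> j \<noteq> l}"

definition clifford_ideal :: "nat \<Rightarrow> (nat list \<Rightarrow> complex) set" where
  "clifford_ideal n = Idl\<^bsub>free_algebra n\<^esub> (clifford_relations n)"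

definition clifford_algebra :: "nat \<Rightarrow> (nat list \<Rightarrow> complex) set ring" where
  "clifford_algebra n = free_algebra n Quot clifford_ideal n"

definition clifford_gen :: "nat \<Rightarrow> nat \<Rightarrow> (nat list \<Rightarrow> complex) set" where
  "clifford_gen n j = clifford_ideal n +>\<^bsub>free_algebra n\<^esub> word [j]"

definition clifford_prod :: "nat \<Rightarrow> nat list \<Rightarrow> (nat list \<Rightarrow> complex) set" where
  "clifford_prod n \<mu> =
     foldr (\<lambda>i x. clifford_gen n i \<otimes>\<^bsub>clifford_algebra n\<^esub> x) \<mu> \<one>\<^bsub>clifford_algebra n\<^esub>"

definition increasing_words :: "nat \<Rightarrow> nat list set" where
  "increasing_words n = {\<mu>. sorted_wrt (<) \<mu> \<and> set \<mu> \<subseteq> {1..n}}"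

text \<open>The group \<open>\<Gamma>\<close>-hat with index \<open>2k\<close>, under the multiplication of the Clifford algebra.\<close>

definition Gamma_hat :: "nat \<Rightarrow> (nat list \<Rightarrow> complex) set monoid" where
  "Gamma_hat k =
    \<lparr> carrier = clifford_prod (2*k) ` increasing_words (2*k) \<union>
        (\<lambda>\<mu>. \<ominus>\<^bsub>clifford_algebra (2*k)\<^esub> clifford_prod (2*k) \<mu>) ` increasing_words (2*k),
      monoid.mult = monoid.mult (clifford_algebra (2*k)),
      one = \<one>\<^bsub>clifford_algebra (2*k)\<^esub> \<rparr>"


section \<open>The representation\<close>

definition kron :: "complex mat \<Rightarrow> complex mat \<Rightarrow> complex mat" where
  "kron M N = mat (dim_row M * dim_row N) (dim_col M * dim_col N)
     (\<lambda>(r, c). M $$ (r div dim_row N, c div dim_col N) * N $$ (r mod dim_row N, c mod dim_col N))"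

primrec kron_pow :: "complex mat \<Rightarrow> nat \<Rightarrow> complex mat" where
  "kron_pow M 0 = 1\<^sub>m 1"
| "kron_pow M (Suc m) = kron M (kron_pow M m)"

definition E1 :: "complex mat" where
  "E1 = mat_of_rows_list 2 [[\<i>, 0], [0, -\<i>]]"

definition E2 :: "complex mat" where
  "E2 = mat_of_rows_list 2 [[0, \<i>], [\<i>, 0]]"

definition Bmat :: "complex mat" where
  "Bmat = mat_of_rows_list 2 [[0, -\<i>], [\<i>, 0]]"

text \<open>Both \<open>i = 2j - 1\<close> and \<open>i = 2j\<close> give \<open>j = (i + 1) div 2\<close>.\<close>

definition rho_gen :: "nat \<Rightarrow> nat \<Rightarrow> complex mat" where
  "rho_gen k i = (let j = (i + 1) div 2 in
     kron (kron_pow (1\<^sub>m 2) (k - j)) (kron (if odd i then E1 else E2) (kron_pow Bmat (j - 1))))"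

definition rho_word :: "nat \<Rightarrow> nat list \<Rightarrow> complex mat" where
  "rho_word k w = foldr (\<lambda>i M. rho_gen k i * M) w (1\<^sub>m (2^k))"

text \<open>The multiplicative and complex-linear extension to the free algebra.\<close>

definition rho_free :: "nat \<Rightarrow> (nat list \<Rightarrow> complex) \<Rightarrow> complex mat" where
  "rho_free k f = mat (2^k) (2^k) (\<lambda>(r, c). \<Sum>w | f w \<noteq> 0. f w * rho_word k w $$ (r, c))"

text \<open>
  The extension annihilates the Clifford ideal, so it is constant on each coset; \<open>rho\<close> is the
  induced map on the Clifford algebra with \<open>2k\<close> generators.
\<close>

definition rho :: "nat \<Rightarrow> (nat list \<Rightarrow> complex) set \<Rightarrow> complex mat" where
  "rho k a = the_elem (rho_free k ` a)"

definition rho_Gamma_hat :: "nat \<Rightarrow> complex mat monoid" where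
  "rho_Gamma_hat k =
    \<lparr> carrier = rho k ` carrier (Gamma_hat k), monoid.mult = (*), one = 1\<^sub>m (2^k) \<rparr>"


section \<open>The torus and its 2-torsion\<close>

definition gauss_lattice :: "nat \<Rightarrow> complex vec set" where
  "gauss_lattice N = {v \<in> carrier_vec N. \<forall>i<N. Re (v $ i) \<in> \<int> \<and> Im (v $ i) \<in> \<int>}"

text \<open>The group operation of \<open>torus k\<close>, addition of cosets, is written multiplicatively.\<close>

definition torus :: "nat \<Rightarrow> complex vec set monoid" where
  "torus k = module_vec TYPE(complex) (2^k) A_Mod gauss_lattice (2^k)"

definition J2 :: "nat \<Rightarrow> complex vec set set" where
  "J2 k = {x \<in> carrier (torus k). x \<otimes>\<^bsub>torus k\<^esub> x = \<one>\<^bsub>torus k\<^esub>}"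

text \<open>
  The class of \<open>v\<close> is sent to the class of \<open>M v\<close>. If the entries of \<open>M\<close> are Gaussian integers,
  all cosets in the union coincide.
\<close>

definition torus_act :: "nat \<Rightarrow> complex mat \<Rightarrow> complex vec set \<Rightarrow> complex vec set" where
  "torus_act k M x =
     (\<Union>v\<in>x. gauss_lattice (2^k) +>\<^bsub>module_vec TYPE(complex) (2^k)\<^esub> (M *\<^sub>v v))"


section \<open>Quotient groups\<close>

text \<open>
  The set of classes with \<open>[a][b] = [ab]\<close>; the union is a single class exactly when the product
  does not depend on the representatives.
\<close>

definition quotient_group :: "('a, 'b) monoid_scheme \<Rightarrow> ('a \<times> 'a) set \<Rightarrow> 'a set monoid" where
  "quotient_group G r =
    \<lparr> carrier = carrier G // r,
      monoid.mult = (\<lambda>X Y. \<Union>a\<in>X. \<Union>b\<in>Y. r `` {a \<otimes>\<^bsub>G\<^esub> b}),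
      one = r `` {\<one>\<^bsub>G\<^esub>} \<rparr>"

definition torsion_rel ::
    "nat \<Rightarrow> ((nat list \<Rightarrow> complex) set \<times> (nat list \<Rightarrow> complex) set) set" where
  "torsion_rel k = {(a, b). a \<in> carrier (Gamma_hat k) \<and> b \<in> carrier (Gamma_hat k) \<and>
     (\<forall>v\<in>J2 k. torus_act k (rho k a) v = torus_act k (rho k b) v)}"

definition entry_sign_rel :: "nat \<Rightarrow> (complex mat \<times> complex mat) set" where
  "entry_sign_rel k =
     {(M, N). M \<in> carrier (rho_Gamma_hat k) \<and> N \<in> carrier (rho_Gamma_hat k) \<and>
        (\<forall>r<2^k. \<forall>c<2^k. N $$ (r, c) = M $$ (r, c) \<or> N $$ (r, c) = - M $$ (r, c))}"

definition Gamma_hat_mod :: "nat \<Rightarrow> (nat list \<Rightarrow> complex) set set monoid" where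
  "Gamma_hat_mod k = quotient_group (Gamma_hat k) (torsion_rel k)"

definition rho_Gamma_hat_mod :: "nat \<Rightarrow> complex mat set monoid" where
  "rho_Gamma_hat_mod k = quotient_group (rho_Gamma_hat k) (entry_sign_rel k)"


section \<open>Switch permutations\<close>

text \<open>
  \<open>switch_perm k j\<close> is the permutation \<open>A\<close> with index \<open>2^j\<close>. The element \<open>x\<close> lies in the block
  with 0-based number \<open>(x - 1) div 2^j\<close>.
\<close>

definition switch_perm :: "nat \<Rightarrow> nat \<Rightarrow> nat \<Rightarrow> nat" where
  "switch_perm k j x =
     (if x \<in> {1..2^k} then if even ((x - 1) div 2^j) then x + 2^j else x - 2^j else x)"

definition cliff_alt :: "nat \<Rightarrow> (nat \<Rightarrow> nat) monoid" where
  "cliff_alt k = (sym_group (2^k))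
     \<lparr> carrier := {fold (\<circ>) (map S [1..<Suc k]) id | S.
         \<forall>l\<in>{1..k}. S l \<in> {id, switch_perm k (l - 1)}} \<rparr>"

end

theory Submission
  imports Defs "HOL-Computational_Algebra.Formal_Power_Series"
begin

unbundle bit_operations_syntax

text \<open>
  With rows and columns numbered from 0, every \<open>\<rho>(e\<^sub>\<mu>)\<close> is a monomial matrix supported on the graph of
  \<open>c \<mapsto> c XOR m\<close>, and all its nonzero entries agree with one power \<open>\<i>\<^sup>t\<close> up to sign: this holds for
  \<open>E\<^sub>1\<close>, \<open>E\<^sub>2\<close>, \<open>B\<close> and is stable under Kronecker and matrix products, under which \<open>t\<close> adds up and
  the masks \<open>m\<close> are concatenated and xor-ed, respectively. Both acting on the half lattice points modulo
  the lattice and forgetting the signs of the entries retain precisely the pair \<open>(t mod 2, m)\<close>.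
  The switch permutations are the maps \<open>c \<mapsto> c XOR m\<close>, so the pair is an element of
  \<open>\<int>\<^sub>2 \<times> Cliff(Alt(2\<^sup>k))\<close>; all pairs occur because \<open>e\<^sub>1\<close> gives \<open>(1, 0)\<close> and \<open>e\<^sub>2\<^sub>j\<close> has mask \<open>2\<^sup>j - 1\<close>.
\<close>

section \<open>Exclusive or below a power of two\<close>

text \<open>Anticommutation makes the Clifford group noncommutative only through signs, and both
  quotients ignore signs. So no sign is ever tracked: all statements about matrices concern the
  squares of entries. The factor of order 2 is the group of units of the Gaussian integers modulo
  -1. On 2-torsion -1 acts trivially because x = -x, whereas (e - e')/2 is not a Gaussian integer
  for units e, e' with e' different from e and -e.

  Two obstacles precede this computation. The group is listed by increasing words in a presented
  algebra, so closure under multiplication needs a normal form obtained by sorting. And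
  \<open>rho\<close> is a map on cosets, so it has values only after the matrices are shown to
  satisfy the Clifford relations.

  The product group is the common target of two maps whose fibres are the two kinds of classes. Its
  group laws are transported to the quotients, and the second isomorphism is obtained by passing
  through it.\<close>

lemma xor_less_power2: "m < 2 ^ a \<Longrightarrow> n < 2 ^ a \<Longrightarrow> m XOR n < 2 ^ a" for m n :: nat
  by (metis take_bit_nat_eq_self_iff take_bit_xor)

lemma xor_cancel: "(m XOR n) XOR n = m" "m XOR (m XOR n) = n" for m n :: nat
  by (simp_all add: xor.assoc flip: xor.assoc[of m m])

lemma eq_xor_iff: "r = c XOR m \<longleftrightarrow> c = r XOR m" for r c m :: nat
  by (metis xor_cancel(1))

lemma xor_div_power2: "(m XOR n) div 2 ^ b = (m div 2 ^ b) XOR (n div 2 ^ b)" for m n :: nat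
  by (metis drop_bit_eq_div drop_bit_xor)

lemma xor_mod_power2: "(m XOR n) mod 2 ^ b = (m mod 2 ^ b) XOR (n mod 2 ^ b)" for m n :: nat
  by (metis take_bit_eq_mod take_bit_xor)

lemma add_power2_eq_xor: "m < 2 ^ j \<Longrightarrow> 2 ^ j + m = m XOR 2 ^ j" for m :: nat
proof (rule trans[OF disjunctive_add_eq_xor])
  assume m: "m < 2 ^ j"
  show "2 ^ j AND m = 0"
    using m by (metis and.commute take_bit_nat_eq_self_iff and_exp_eq_0_iff_not_bit bit_take_bit_iff less_irrefl)
qed (simp add: xor.commute)

text \<open>The parity of the block number \<open>x div 2 ^ j\<close> is bit \<open>j\<close> of
  \<open>x\<close>, so moving to the partner block amounts to flipping that bit.\<close>

lemma xor_power2: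
  "x XOR 2 ^ j = (if even (x div 2 ^ j) then x + 2 ^ j else x - 2 ^ j)" for x :: nat
proof (cases "even (x div 2 ^ j)")
  case True
  then have "x AND 2 ^ j = 0"
    by (simp add: and_exp_eq_0_iff_not_bit bit_iff_odd)
  with True show ?thesis
    by (simp add: disjunctive_add_eq_xor)
next
  case False
  \<comment> \<open>Bit \<open>j\<close> of \<open>y\<close> is clear, so the case of a clear bit,
    read for \<open>y\<close>, recovers \<open>x\<close> from \<open>y\<close> by adding
    \<open>2 ^ j\<close>.\<close>
  define y where "y = x XOR 2 ^ j"
  have "\<not> bit y j"
    using False by (simp add: y_def bit_xor_iff bit_iff_odd[of x] bit_exp_iff)
  then have "y AND 2 ^ j = 0"
    by (simp add: and_exp_eq_0_iff_not_bit)
  then have "y + 2 ^ j = y XOR 2 ^ j"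
    by (simp add: disjunctive_add_eq_xor)
  also have "\<dots> = x"
    by (simp add: y_def xor_cancel)
  finally show ?thesis
    using False by (simp add: y_def)
qed

section \<open>Kronecker products\<close>

lemma dim_kron [simp]:
  "dim_row (kron A B) = dim_row A * dim_row B" "dim_col (kron A B) = dim_col A * dim_col B"
  by (simp_all add: kron_def)

lemma dim_kron_pow [simp]:
  "dim_row (kron_pow A j) = dim_row A ^ j" "dim_col (kron_pow A j) = dim_col A ^ j"
  by (induction j) simp_all

lemma index_kron:
  "r < dim_row A * dim_row B \<Longrightarrow> c < dim_col A * dim_col B \<Longrightarrow>
    kron A B $$ (r, c) = A $$ (r div dim_row B, c div dim_col B) * B $$ (r mod dim_row B, c mod dim_col B)"
  by (simp add: kron_def)

text \<open>Row and column indices have three mixed-radix digits, and either bracketing multiplies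
  the entries of \<open>A\<close>, \<open>B\<close>, \<open>C\<close> at the same digits. The facts
  \<open>d\<close> compute these digits along both routes.\<close>

lemma kron_assoc: "kron (kron A B) C = kron A (kron B C)"
proof (rule eq_matI)
  fix r c assume "r < dim_row (kron A (kron B C))" "c < dim_col (kron A (kron B C))"
  then have r: "r < dim_row A * (dim_row B * dim_row C)" and c: "c < dim_col A * (dim_col B * dim_col C)"
    by simp_all
  have d: "x mod (m * n) div n = x div n mod m" "x mod (m * n) mod n = x mod n"
    "x div (m * n) = x div n div m"
    "x mod (m * n) < m * n" "x div n < l * m" "x mod n < n" "x div n div m < l"
    "x div n mod m < m"
    if x: "x < l * (m * n)" for x l m n :: nat
  proof -
    have "n > 0" "m > 0" using x by (auto intro!: Nat.gr0I)
    have "x mod (m * n) = n * (x div n mod m) + x mod n"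
      using mod_mult2_eq[of x n m] by (simp only: mult.commute[of m n])
    with \<open>n > 0\<close> show "x mod (m * n) div n = x div n mod m" "x mod (m * n) mod n = x mod n"
      by simp_all
    show "x div (m * n) = x div n div m"
      using div_mult2_eq[of x n m] by (simp only: mult.commute[of m n])
    show "x mod (m * n) < m * n" "x mod n < n" "x div n mod m < m" using \<open>n > 0\<close> \<open>m > 0\<close> by simp_all
    show d: "x div n < l * m" using x \<open>n > 0\<close> by (simp add: div_less_iff_less_mult mult.assoc)
    show "x div n div m < l" using d \<open>m > 0\<close> by (simp add: div_less_iff_less_mult)
  qed
  show "kron (kron A B) C $$ (r, c) = kron A (kron B C) $$ (r, c)"
    by (simp only: index_kron dim_kron mult.assoc r c d[OF r] d[OF c])
qed (simp_all add: mult.assoc)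

lemma kron_uminus_left: "kron (- A) B = - kron A B"
proof (rule eq_matI)
  fix r c assume "r < dim_row (- kron A B)" "c < dim_col (- kron A B)"
  then have r: "r < dim_row A * dim_row B" and c: "c < dim_col A * dim_col B"
    by simp_all
  from r c have "r div dim_row B < dim_row A" "c div dim_col B < dim_col A"
    by (simp_all add: less_mult_imp_div_less)
  with r c show "kron (- A) B $$ (r, c) = (- kron A B) $$ (r, c)"
    by (simp add: index_kron)
qed simp_all

lemma kron_uminus_right: "kron A (- B) = - kron A B"
proof (rule eq_matI)
  fix r c assume "r < dim_row (- kron A B)" "c < dim_col (- kron A B)"
  then have r: "r < dim_row A * dim_row B" and c: "c < dim_col A * dim_col B"
    by simp_all
  from r c have "dim_row B > 0" "dim_col B > 0"
    by (auto intro!: Nat.gr0I)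
  with r c show "kron A (- B) $$ (r, c) = (- kron A B) $$ (r, c)"
    by (simp add: index_kron)
qed simp_all

lemma kron_one_one: "kron (1\<^sub>m a) (1\<^sub>m b) = 1\<^sub>m (a * b)"
proof (rule eq_matI)
  fix r c assume "r < dim_row (1\<^sub>m (a * b) :: complex mat)" "c < dim_col (1\<^sub>m (a * b) :: complex mat)"
  then have r: "r < a * b" and c: "c < a * b"
    by simp_all
  from r have "b > 0"
    by (auto intro!: Nat.gr0I)
  moreover have "r div b < a" "c div b < a"
    using r c by (simp_all add: less_mult_imp_div_less)
  moreover have "r = c \<longleftrightarrow> r div b = c div b \<and> r mod b = c mod b"
    by (metis div_mult_mod_eq)
  ultimately show "kron (1\<^sub>m a) (1\<^sub>m b) $$ (r, c) = 1\<^sub>m (a * b) $$ (r, c)"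
    using r c by (simp add: index_kron)
qed simp_all

lemma kron_one_left: "kron (1\<^sub>m 1) A = A"
  by (rule eq_matI) (simp_all add: index_kron)

lemma kron_pow_one: "kron_pow (1\<^sub>m a) j = 1\<^sub>m (a ^ j)"
  by (induction j) (simp_all add: kron_one_one)

section \<open>The mixed-product rule for Kronecker products\<close>

lemma sum_div_mod:
  fixes f :: "nat \<Rightarrow> nat \<Rightarrow> 'a :: comm_monoid_add"
  shows "(\<Sum>u<a * b. f (u div b) (u mod b)) = (\<Sum>x<a. \<Sum>y<b. f x y)"
proof -
  have "x * b + y < a * b" if "x < a" "y < b" for x y
  proof -
    have "x * b + y < Suc x * b"
      using that by simp
    also have "\<dots> \<le> a * b"
      using that by (intro mult_le_mono1) simp
    finally show ?thesis .
  qed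
  moreover have "b > 0" if "u < a * b" for u
    using that by (auto intro!: Nat.gr0I)
  ultimately show ?thesis
    unfolding sum.cartesian_product
    by (intro sum.reindex_bij_witness[of _ "\<lambda>(x, y). x * b + y" "\<lambda>u. (u div b, u mod b)"])
      (auto simp: less_mult_imp_div_less)
qed

text \<open>The summation index of the matrix product splits into quotient and remainder by
  \<open>b\<close>; the summand factors accordingly, so the sum becomes a product of two
  sums.\<close>

lemma kron_mult:
  assumes "A \<in> carrier_mat a a" "C \<in> carrier_mat a a" "B \<in> carrier_mat b b" "D \<in> carrier_mat b b"
  shows "kron A B * kron C D = kron (A * C) (B * D)"
proof (rule eq_matI)
  fix r c assume "r < dim_row (kron (A * C) (B * D))" "c < dim_col (kron (A * C) (B * D))"
  then have r: "r < a * b" and c: "c < a * b"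
    using assms by simp_all
  from r have b: "b > 0"
    by (auto intro!: Nat.gr0I)
  have d: "r div b < a" "c div b < a"
    using r c by (simp_all add: less_mult_imp_div_less)
  have "(kron A B * kron C D) $$ (r, c) = (\<Sum>u<a * b. kron A B $$ (r, u) * kron C D $$ (u, c))"
    using assms r c by (simp add: scalar_prod_def lessThan_atLeast0)
  also have "\<dots> = (\<Sum>u<a * b. A $$ (r div b, u div b) * B $$ (r mod b, u mod b) *
      (C $$ (u div b, c div b) * D $$ (u mod b, c mod b)))"
    using assms r c by (intro sum.cong) (auto simp: index_kron)
  also have "\<dots> = (\<Sum>x<a. \<Sum>y<b. A $$ (r div b, x) * B $$ (r mod b, y) *
      (C $$ (x, c div b) * D $$ (y, c mod b)))"
    by (rule sum_div_mod)
  also have "\<dots> = (\<Sum>x<a. A $$ (r div b, x) * C $$ (x, c div b)) *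
      (\<Sum>y<b. B $$ (r mod b, y) * D $$ (y, c mod b))"
    by (simp add: sum_product ac_simps)
  also have "\<dots> = kron (A * C) (B * D) $$ (r, c)"
    using assms r c d b by (simp add: index_kron scalar_prod_def lessThan_atLeast0)
  finally show "(kron A B * kron C D) $$ (r, c) = kron (A * C) (B * D) $$ (r, c)" .
qed (use assms in simp_all)

section \<open>The representing matrices\<close>

lemma carrier_E [simp]: "E1 \<in> carrier_mat 2 2" "E2 \<in> carrier_mat 2 2" "Bmat \<in> carrier_mat 2 2"
  by (simp_all add: E1_def E2_def Bmat_def mat_of_rows_list_def numeral_2_eq_2)

lemma dim_E [simp]:
  "dim_row E1 = 2" "dim_col E1 = 2" "dim_row E2 = 2" "dim_col E2 = 2" "dim_row Bmat = 2" "dim_col Bmat = 2"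
  by (simp_all add: E1_def E2_def Bmat_def mat_of_rows_list_def)

lemma index_E:
  "r < 2 \<Longrightarrow> c < 2 \<Longrightarrow> E1 $$ (r, c) = (if r = c then if r = 0 then \<i> else - \<i> else 0)"
  "r < 2 \<Longrightarrow> c < 2 \<Longrightarrow> E2 $$ (r, c) = (if r = c then 0 else \<i>)"
  "r < 2 \<Longrightarrow> c < 2 \<Longrightarrow> Bmat $$ (r, c) = (if r = c then 0 else if r = 0 then - \<i> else \<i>)"
  by (auto simp: E1_def E2_def Bmat_def mat_of_rows_list_def less_Suc_eq numeral_2_eq_2)

lemma E_mult:
  "E1 * E1 = - 1\<^sub>m 2" "E2 * E2 = - 1\<^sub>m 2" "Bmat * Bmat = 1\<^sub>m 2"
  "E1 * E2 = - (E2 * E1)" "E1 * Bmat = - (Bmat * E1)" "E2 * Bmat = - (Bmat * E2)"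
  by (rule eq_matI; auto simp: scalar_prod_def index_E lessThan_atLeast0[symmetric] numeral_2_eq_2 less_Suc_eq)+

lemma kron_pow_Bmat:
  "kron_pow Bmat k \<in> carrier_mat (2 ^ k) (2 ^ k)"
  "kron_pow Bmat k * kron_pow Bmat k = 1\<^sub>m (2 ^ k)"
proof (induction k)
  case (Suc k)
  { case 1 show ?case by (rule carrier_matI) simp_all }
  { case 2 show ?case
      using Suc by (simp add: kron_mult[where a = 2 and b = "2 ^ k"] E_mult kron_one_one) }
qed simp_all

section \<open>The Clifford relations for the representing matrices\<close>

lemma rho_gen_carrier:
  assumes "i \<in> {1..2 * k}"
  shows "rho_gen k i \<in> carrier_mat (2 ^ k) (2 ^ k)"
proof -
  define j where "j = (i + 1) div 2"
  from assms have "1 \<le> j" "j \<le> k"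
    unfolding j_def by auto
  then have "(2 :: nat) ^ (k - j) * (2 * 2 ^ (j - 1)) = 2 ^ k"
    by (simp flip: power_Suc power_add)
  then show ?thesis
    unfolding rho_gen_def Let_def j_def[symmetric]
    by (intro carrier_matI; cases "odd i") simp_all
qed

text \<open>Raising \<open>k\<close> by one only lengthens the leading string of identity factors of
  an existing generator. Together with \<open>rho_gen_new\<close> this gives a recursion on
  \<open>k\<close>.\<close>

lemma rho_gen_Suc:
  assumes "i \<in> {1..2 * k}"
  shows "rho_gen (Suc k) i = kron (1\<^sub>m 2) (rho_gen k i)"
proof -
  from assms have "(i + 1) div 2 \<le> k"
    by auto
  then show ?thesis
    by (simp add: rho_gen_def Let_def Suc_diff_le kron_assoc del: One_nat_def)
qed

lemma rho_gen_new:
  "rho_gen (Suc k) (Suc (2 * k)) = kron E1 (kron_pow Bmat k)"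
  "rho_gen (Suc k) (Suc (Suc (2 * k))) = kron E2 (kron_pow Bmat k)"
  by (simp_all add: rho_gen_def Let_def kron_one_left[simplified])

text \<open>The second claim is there for the induction. An old generator becomes
  \<open>kron (1\<^sub>m 2) g\<close> and a new one is \<open>kron E (kron_pow Bmat k)\<close> with
  \<open>E\<close> being \<open>E1\<close> or \<open>E2\<close>, so these two can anticommute only
  in the second factor, where \<open>g\<close> meets \<open>kron_pow Bmat k\<close>. The two new
  generators anticommute in the first factor, and they square to -1 because
  \<open>kron_pow Bmat k\<close> squares to 1.\<close>

lemma rho_gen_relations:
  shows "i \<in> {1..2 * k} \<Longrightarrow> rho_gen k i * rho_gen k i = - 1\<^sub>m (2 ^ k)"
    and "i \<in> {1..2 * k} \<Longrightarrow> rho_gen k i * kron_pow Bmat k = - (kron_pow Bmat k * rho_gen k i)"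
    and "i \<in> {1..2 * k} \<Longrightarrow> j \<in> {1..2 * k} \<Longrightarrow> i \<noteq> j \<Longrightarrow>
      rho_gen k i * rho_gen k j = - (rho_gen k j * rho_gen k i)"
proof (induction k arbitrary: i j)
  case (Suc k)
  note simps = kron_mult[where a = 2 and b = "2 ^ k"] E_mult kron_pow_Bmat rho_gen_carrier
    kron_uminus_left kron_uminus_right kron_one_one rho_gen_new rho_gen_Suc
  have cases: "i \<in> {1..2 * k} \<or> i = Suc (2 * k) \<or> i = Suc (Suc (2 * k))"
    if "i \<in> {1..2 * Suc k}" for i
    using that by auto
  { case 1
    then show ?case
      using cases[of i] by (auto simp: simps Suc.IH(1) simp del: One_nat_def atLeastAtMost_iff) }
  { case 2
    then show ?case
      using cases[of i] by (auto simp: simps Suc.IH(2) simp del: One_nat_def atLeastAtMost_iff) }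
  let ?anti = "\<lambda>i j. rho_gen (Suc k) i * rho_gen (Suc k) j = - (rho_gen (Suc k) j * rho_gen (Suc k) i)"
  have sym: "?anti j i" if "?anti i j" for i j
    using that by simp
  have old_old: "?anti i j" if "i \<in> {1..2 * k}" "j \<in> {1..2 * k}" "i \<noteq> j" for i j
    using that(1,2) Suc.IH(3)[OF that] by (simp add: simps del: One_nat_def atLeastAtMost_iff)
  have old_new: "?anti i (Suc (2 * k))" "?anti i (Suc (Suc (2 * k)))" if "i \<in> {1..2 * k}" for i
    using that Suc.IH(2)[OF that] by (simp_all add: simps del: One_nat_def atLeastAtMost_iff)
  have new_new: "?anti (Suc (2 * k)) (Suc (Suc (2 * k)))"
    by (simp add: simps)
  { case 3
    then show ?case
      using cases[of i] cases[of j] old_old old_new new_new sym by blast }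
qed simp_all

section \<open>Monomial matrices\<close>

text \<open>Squaring the entries records exactly what survives a change of signs: the support, which is
  the graph of \<open>c \<mapsto> c XOR m\<close>, and the power of \<open>\<i>\<close> modulo \<open>\<plusminus>1\<close>.\<close>

definition xor_monomial :: "nat \<Rightarrow> nat \<Rightarrow> nat \<Rightarrow> complex mat \<Rightarrow> bool" where
  "xor_monomial a t m M \<longleftrightarrow> M \<in> carrier_mat (2 ^ a) (2 ^ a) \<and> m < 2 ^ a \<and>
     (\<forall>r<2 ^ a. \<forall>c<2 ^ a. (M $$ (r, c))\<^sup>2 = (if r = c XOR m then (-1) ^ t else 0))"

lemma xor_monomialD:
  assumes "xor_monomial a t m M"
  shows "M \<in> carrier_mat (2 ^ a) (2 ^ a)" "dim_row M = 2 ^ a" "dim_col M = 2 ^ a" "m < 2 ^ a"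
    and "r < 2 ^ a \<Longrightarrow> c < 2 ^ a \<Longrightarrow> (M $$ (r, c))\<^sup>2 = (if r = c XOR m then (-1) ^ t else 0)"
  using assms by (auto simp: xor_monomial_def)

lemma xor_monomial_one: "xor_monomial a 0 0 (1\<^sub>m (2 ^ a))"
  by (simp add: xor_monomial_def)

lemma xor_monomial_uminus:
  assumes "xor_monomial a t m M"
  shows "xor_monomial a t m (- M)"
  unfolding xor_monomial_def
proof (intro conjI allI impI)
  fix r c :: nat assume "r < 2 ^ a" "c < 2 ^ a"
  then have "((- M) $$ (r, c))\<^sup>2 = (M $$ (r, c))\<^sup>2"
    using xor_monomialD[OF assms] by simp
  also have "\<dots> = (if r = c XOR m then (-1) ^ t else 0)"
    using \<open>r < 2 ^ a\<close> \<open>c < 2 ^ a\<close> by (rule xor_monomialD(5)[OF assms])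
  finally show "((- M) $$ (r, c))\<^sup>2 = (if r = c XOR m then (-1) ^ t else 0)" .
qed (use xor_monomialD[OF assms] in simp_all)

text \<open>Each column of \<open>N\<close> has a single nonzero entry, so every entry of the
  product is one product of entries and its square is a product of squares.\<close>

lemma xor_monomial_mult:
  assumes M: "xor_monomial a s m M" and N: "xor_monomial a t n N"
  shows "xor_monomial a (s + t) (m XOR n) (M * N)"
  unfolding xor_monomial_def
proof (intro conjI allI impI)
  note [simp] = xor_monomialD[OF M] xor_monomialD[OF N]
  show "M * N \<in> carrier_mat (2 ^ a) (2 ^ a)"
    by (rule mult_carrier_mat[of _ _ "2 ^ a"]) simp_all
  show "m XOR n < 2 ^ a"
    by (simp add: xor_less_power2)
  fix r c :: nat assume r: "r < 2 ^ a" and c: "c < 2 ^ a"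
  \<comment> \<open>The only row in which column \<open>c\<close> of \<open>N\<close> does not
    vanish.\<close>
  define u where "u = c XOR n"
  have u: "u < 2 ^ a"
    unfolding u_def using c by (simp add: xor_less_power2)
  have "N $$ (v, c) = 0" if "v < 2 ^ a" "v \<noteq> u" for v
    using xor_monomialD(5)[OF N that(1) c] that(2) by (simp add: u_def)
  then have "(\<Sum>v<2 ^ a. M $$ (r, v) * N $$ (v, c)) =
      (\<Sum>v<2 ^ a. if v = u then M $$ (r, v) * N $$ (v, c) else 0)"
    by (intro sum.cong) auto
  then have "(M * N) $$ (r, c) = (\<Sum>v<2 ^ a. if v = u then M $$ (r, v) * N $$ (v, c) else 0)"
    using r c by (simp add: scalar_prod_def flip: lessThan_atLeast0 del: sum.delta)
  also have "\<dots> = M $$ (r, u) * N $$ (u, c)"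
    using u by simp
  finally have "((M * N) $$ (r, c))\<^sup>2 = (M $$ (r, u))\<^sup>2 * (N $$ (u, c))\<^sup>2"
    by (simp add: power_mult_distrib)
  also have "\<dots> = (if r = u XOR m then (-1) ^ (s + t) else 0)"
    using r c u by (simp add: power_add u_def)
  also have "r = u XOR m \<longleftrightarrow> r = c XOR (m XOR n)"
    by (simp add: u_def ac_simps)
  finally show "((M * N) $$ (r, c))\<^sup>2 = (if r = c XOR (m XOR n) then (-1) ^ (s + t) else 0)" .
qed

text \<open>Xor acts separately on the lowest \<open>b\<close> bits and on the bits above them,
  exactly as quotient and remainder by \<open>2 ^ b\<close> separate the indices of the two
  factors.\<close>

lemma xor_monomial_kron:
  assumes M: "xor_monomial a s m M" and N: "xor_monomial b t n N"
  shows "xor_monomial (a + b) (s + t) (m * 2 ^ b + n) (kron M N)"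
  unfolding xor_monomial_def
proof (intro conjI allI impI)
  note [simp] = xor_monomialD[OF M] xor_monomialD[OF N]
  show "kron M N \<in> carrier_mat (2 ^ (a + b)) (2 ^ (a + b))"
    by (intro carrier_matI) (simp_all add: power_add)
  have "m * 2 ^ b + n < Suc m * 2 ^ b"
    by simp
  also have "\<dots> \<le> 2 ^ a * 2 ^ b"
    using xor_monomialD(4)[OF M] by (intro mult_le_mono1 Suc_leI)
  finally show "m * 2 ^ b + n < 2 ^ (a + b)"
    by (simp add: power_add)
  fix r c :: nat assume r: "r < 2 ^ (a + b)" and c: "c < 2 ^ (a + b)"
  then have d: "r div 2 ^ b < 2 ^ a" "c div 2 ^ b < 2 ^ a"
    by (simp_all add: less_mult_imp_div_less power_add)
  have "(kron M N $$ (r, c))\<^sup>2 =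
      (M $$ (r div 2 ^ b, c div 2 ^ b))\<^sup>2 * (N $$ (r mod 2 ^ b, c mod 2 ^ b))\<^sup>2"
    using r c by (simp add: index_kron power_add power_mult_distrib)
  also have "\<dots> = (if r div 2 ^ b = (c div 2 ^ b) XOR m \<and> r mod 2 ^ b = (c mod 2 ^ b) XOR n
      then (-1) ^ (s + t) else 0)"
    using d by (simp add: power_add)
  also have "r div 2 ^ b = (c div 2 ^ b) XOR m \<and> r mod 2 ^ b = (c mod 2 ^ b) XOR n \<longleftrightarrow>
      r = c XOR (m * 2 ^ b + n)"
  proof -
    have "(c XOR (m * 2 ^ b + n)) div 2 ^ b = (c div 2 ^ b) XOR m"
      "(c XOR (m * 2 ^ b + n)) mod 2 ^ b = (c mod 2 ^ b) XOR n"
      by (simp_all add: xor_div_power2 xor_mod_power2)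
    then show ?thesis
      by (metis div_mult_mod_eq)
  qed
  finally show "(kron M N $$ (r, c))\<^sup>2 = (if r = c XOR (m * 2 ^ b + n) then (-1) ^ (s + t) else 0)" .
qed

lemma xor_monomial_E:
  "xor_monomial 1 1 0 E1" "xor_monomial 1 1 1 E2" "xor_monomial 1 1 1 Bmat"
  by (auto simp: xor_monomial_def index_E less_Suc_eq numeral_2_eq_2 power2_eq_square)

text \<open>Each factor flips its own bit, so all \<open>j\<close> bits of the mask are set.\<close>

lemma xor_monomial_kron_pow_Bmat: "xor_monomial j j (2 ^ j - 1) (kron_pow Bmat j)"
proof (induction j)
  case 0
  then show ?case
    using xor_monomial_one[of 0] by simp
next
  case (Suc j)
  have "(1 :: nat) \<le> 2 ^ j"
    by simp
  then have "1 * 2 ^ j + (2 ^ j - 1) = 2 * 2 ^ j - (1 :: nat)"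
    by linarith
  with xor_monomial_kron[OF xor_monomial_E(3) Suc] show ?case
    by simp
qed

text \<open>With \<open>j = (i + 1) div 2\<close> there are \<open>j\<close> factors other than
  identities, each contributing one \<i>. The \<open>j - 1\<close> factors \<open>Bmat\<close> flip
  the lowest \<open>j - 1\<close> bits. \<open>E1\<close> is diagonal and flips nothing, while
  \<open>E2\<close> flips the next bit, so the number of flipped bits is \<open>i div 2\<close> for
  either parity of \<open>i\<close>.\<close>

lemma xor_monomial_rho_gen:
  assumes "i \<in> {1..2 * k}"
  shows "xor_monomial k ((i + 1) div 2) (2 ^ (i div 2) - 1) (rho_gen k i)"
proof -
  define j where "j = (i + 1) div 2"
  from assms have j: "1 \<le> j" "j \<le> k"
    unfolding j_def by auto
  have E: "xor_monomial 1 1 (of_bool (even i)) (if odd i then E1 else E2)"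
    using xor_monomial_E by simp
  have I: "xor_monomial (k - j) 0 0 (kron_pow (1\<^sub>m 2) (k - j))"
    unfolding kron_pow_one by (rule xor_monomial_one)
  have "of_bool (even i) * 2 ^ (j - 1) + (2 ^ (j - 1) - 1) = 2 ^ (i div 2) - (1 :: nat)"
  proof (cases "even i")
    case True
    then have "i div 2 = Suc (j - 1)"
      using j by (simp add: j_def)
    moreover have "(1 :: nat) \<le> 2 ^ (j - 1)"
      by simp
    ultimately show ?thesis
      using True by simp
  qed (simp add: j_def)
  with xor_monomial_kron[OF I xor_monomial_kron[OF E xor_monomial_kron_pow_Bmat[of "j - 1"]]] j
  show ?thesis
    unfolding rho_gen_def Let_def j_def[symmetric] by (simp add: ac_simps)
qed

section \<open>Phases and masks of words in the generators\<close>

definition word_phase :: "nat list \<Rightarrow> nat" where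
  "word_phase w = (\<Sum>i\<leftarrow>w. (i + 1) div 2)"

definition word_mask :: "nat list \<Rightarrow> nat" where
  "word_mask w = foldr (\<lambda>i m. (2 ^ (i div 2) - 1) XOR m) w 0"

lemma xor_monomial_rho_word:
  "w \<in> lists {1..2 * k} \<Longrightarrow> xor_monomial k (word_phase w) (word_mask w) (rho_word k w)"
proof (induction w)
  case Nil
  then show ?case
    by (simp add: word_phase_def word_mask_def rho_word_def xor_monomial_one)
next
  case (Cons i w)
  then show ?case
    using xor_monomial_mult[OF xor_monomial_rho_gen[of i k]]
    by (simp add: word_phase_def word_mask_def rho_word_def)
qed

text \<open>The masks \<open>2 ^ j - 1\<close> of the even generators have distinct leading bits, so
  over the field with two elements they form a triangular system: the bits of \<open>m\<close> can
  be cleared from the top.\<close>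

lemma word_mask_surj:
  assumes "j \<le> k" "m < 2 ^ j"
  shows "\<exists>w\<in>lists {1..2 * k}. word_mask w = m"
  using assms
proof (induction j arbitrary: m)
  case 0
  then show ?case
    by (intro bexI[of _ "[]"]) (simp_all add: word_mask_def)
next
  case (Suc j)
  show ?case
  proof (cases "m < 2 ^ j")
    case True
    then show ?thesis
      using Suc by simp
  next
    case False
    \<comment> \<open>The mask of the generator \<open>2 * Suc j\<close>. Its leading bit is bit
      \<open>j\<close>, which is set in \<open>m\<close> in this case, so xor with \<open>n\<close>
      clears it.\<close>
    define n :: nat where "n = 2 ^ Suc j - 1"
    have "(1 :: nat) \<le> 2 ^ j"
      by simp
    then have "2 ^ j \<le> n" "n < 2 * 2 ^ j"
      unfolding n_def power_Suc by linarith+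
    then have "m div 2 ^ j = 1" "n div 2 ^ j = 1"
      using False Suc.prems by (auto intro!: div_nat_eqI)
    then have "(m XOR n) div 2 ^ j = 0"
      by (simp add: xor_div_power2)
    then have "m XOR n < 2 ^ j"
      by (simp add: div_eq_0_iff)
    then obtain w where "w \<in> lists {1..2 * k}" "word_mask w = m XOR n"
      using Suc by auto
    then show ?thesis
      using Suc.prems
      by (intro bexI[of _ "2 * Suc j # w"]) (auto simp: word_mask_def n_def xor.commute[of m] xor_cancel)
  qed
qed

text \<open>Generator 1 has mask \<open>2 ^ 0 - 1 = 0\<close> and phase 1, so prefixing it toggles
  the parity and keeps the mask. It exists because \<open>k \<ge> 1\<close>.\<close>

lemma word_phase_mask_surj:
  assumes "k \<ge> 1" "m < 2 ^ k"
  shows "\<exists>w\<in>lists {1..2 * k}. word_mask w = m \<and> (even (word_phase w) \<longleftrightarrow> b)"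
proof -
  obtain w where w: "w \<in> lists {1..2 * k}" "word_mask w = m"
    using word_mask_surj assms by blast
  have "word_mask (1 # w) = word_mask w" "word_phase (1 # w) = Suc (word_phase w)"
    by (simp_all add: word_mask_def word_phase_def)
  moreover have "1 # w \<in> lists {1..2 * k}"
    using w assms by simp
  ultimately show ?thesis
    using w by (metis even_Suc)
qed

text \<open>Two complex numbers agree up to sign exactly when their squares agree, and the squares
  of all entries are known.\<close>

lemma xor_monomial_entry_sign_iff:
  assumes M: "xor_monomial a s m M" and N: "xor_monomial a t n N"
  shows "(\<forall>r<2 ^ a. \<forall>c<2 ^ a. N $$ (r, c) = M $$ (r, c) \<or> N $$ (r, c) = - M $$ (r, c)) \<longleftrightarrow>
    m = n \<and> even s = even t"
proof
  assume "\<forall>r<2 ^ a. \<forall>c<2 ^ a. N $$ (r, c) = M $$ (r, c) \<or> N $$ (r, c) = - M $$ (r, c)"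
  \<comment> \<open>Column 0 of \<open>M\<close> has its only nonzero entry in row
    \<open>0 XOR m = m\<close>; this one position reveals both the mask and the parity.\<close>
  then have "(N $$ (m, 0))\<^sup>2 = (M $$ (m, 0))\<^sup>2"
    using xor_monomialD(4)[OF M] by (simp add: power2_eq_iff)
  then have "(if m = n then (-1) ^ t else 0) = ((-1) ^ s :: complex)"
    using xor_monomialD(4)[OF M] xor_monomialD(5)[OF M, of m 0] xor_monomialD(5)[OF N, of m 0] by simp
  then show "m = n \<and> even s = even t"
    by (auto split: if_splits simp: minus_one_power_iff)
next
  assume "m = n \<and> even s = even t"
  then show "\<forall>r<2 ^ a. \<forall>c<2 ^ a. N $$ (r, c) = M $$ (r, c) \<or> N $$ (r, c) = - M $$ (r, c)"
    using xor_monomialD(5)[OF M] xor_monomialD(5)[OF N]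
    by (simp add: minus_one_power_iff flip: power2_eq_iff)
qed

section \<open>The free algebra\<close>

lemma free_algebra_simps:
  "carrier (free_algebra n) = {f. finite {w. f w \<noteq> 0} \<and> {w. f w \<noteq> 0} \<subseteq> lists {1..n}}"
  "f \<otimes>\<^bsub>free_algebra n\<^esub> g = (\<lambda>w. \<Sum>i\<le>length w. f (take i w) * g (drop i w))"
  "\<one>\<^bsub>free_algebra n\<^esub> = word []"
  "\<zero>\<^bsub>free_algebra n\<^esub> = (\<lambda>w. 0)"
  "f \<oplus>\<^bsub>free_algebra n\<^esub> g = (\<lambda>w. f w + g w)"
  by (simp_all add: free_algebra_def word_def)

lemma word_carrier: "w \<in> lists {1..n} \<Longrightarrow> word w \<in> carrier (free_algebra n)"
  by (auto simp: free_algebra_simps word_def)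

lemma word_mult: "word u \<otimes>\<^bsub>free_algebra n\<^esub> word v = word (u @ v)"
proof
  fix w
  have "(word u \<otimes>\<^bsub>free_algebra n\<^esub> word v) w =
      (\<Sum>i\<le>length w. if i = length u then of_bool (w = u @ v) else 0)"
    unfolding free_algebra_simps
  proof (intro sum.cong refl)
    fix i assume "i \<in> {..length w}"
    then have "take i w = u \<and> drop i w = v \<longleftrightarrow> i = length u \<and> w = u @ v"
      by (auto simp: append_eq_conv_conj)
    then show "word u (take i w) * word v (drop i w) = (if i = length u then of_bool (w = u @ v) else 0)"
      unfolding word_def by auto
  qed
  also have "\<dots> = word (u @ v) w"
    by (simp add: word_def)
  finally show "(word u \<otimes>\<^bsub>free_algebra n\<^esub> word v) w = word (u @ v) w" .
qed

text \<open>This confines the support of a product to finitely many words over the same alphabet; it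
  serves closure of the free algebra and, later, the evaluation of \<open>rho_free\<close> on
  products.\<close>

lemma free_algebra_mult_support:
  "{w. (f \<otimes>\<^bsub>free_algebra n\<^esub> g) w \<noteq> 0} \<subseteq> (\<lambda>(u, v). u @ v) ` ({u. f u \<noteq> 0} \<times> {v. g v \<noteq> 0})"
proof
  fix w assume "w \<in> {w. (f \<otimes>\<^bsub>free_algebra n\<^esub> g) w \<noteq> 0}"
  then obtain i where "f (take i w) * g (drop i w) \<noteq> 0"
    unfolding free_algebra_simps by (auto elim: sum.not_neutral_contains_not_neutral)
  then show "w \<in> (\<lambda>(u, v). u @ v) ` ({u. f u \<noteq> 0} \<times> {v. g v \<noteq> 0})"
    by (intro image_eqI[of _ _ "(take i w, drop i w)"]) auto
qed

lemma free_algebra_mult_assoc: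
  "(f \<otimes>\<^bsub>free_algebra n\<^esub> g) \<otimes>\<^bsub>free_algebra n\<^esub> h = f \<otimes>\<^bsub>free_algebra n\<^esub> (g \<otimes>\<^bsub>free_algebra n\<^esub> h)"
proof
  fix w
  \<comment> \<open>Both sides sum over the ways of cutting \<open>w\<close> into three pieces, of
    lengths \<open>i\<close>, \<open>p\<close> and \<open>q\<close>. The rearrangement is the one
    that proves associativity for formal power series.\<close>
  define F where "F = (\<lambda>i p (q :: nat). f (take i w) * g (take p (drop i w)) * h (drop (i + p) w))"
  have "((f \<otimes>\<^bsub>free_algebra n\<^esub> g) \<otimes>\<^bsub>free_algebra n\<^esub> h) w =
      (\<Sum>j=0..length w. \<Sum>i=0..j. F i (j - i) (length w - j))"
    unfolding free_algebra_simps F_def sum_distrib_right atMost_atLeast0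
    by (intro sum.cong) (auto simp: min_def drop_take)
  also have "\<dots> = (\<Sum>j=0..length w. \<Sum>i=0..length w - j. F j i (length w - j - i))"
    by (rule fps_mult_assoc_lemma)
  also have "\<dots> = (f \<otimes>\<^bsub>free_algebra n\<^esub> (g \<otimes>\<^bsub>free_algebra n\<^esub> h)) w"
    unfolding free_algebra_simps F_def sum_distrib_left atMost_atLeast0
    by (intro sum.cong) (auto simp: ac_simps)
  finally show "((f \<otimes>\<^bsub>free_algebra n\<^esub> g) \<otimes>\<^bsub>free_algebra n\<^esub> h) w =
      (f \<otimes>\<^bsub>free_algebra n\<^esub> (g \<otimes>\<^bsub>free_algebra n\<^esub> h)) w" .
qed

lemma free_algebra_mult_one:
  "word [] \<otimes>\<^bsub>free_algebra n\<^esub> f = f" "f \<otimes>\<^bsub>free_algebra n\<^esub> word [] = f"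
proof (rule_tac [!] ext)
  fix w
  have "(word [] \<otimes>\<^bsub>free_algebra n\<^esub> f) w = (\<Sum>i\<le>length w. if i = 0 then f w else 0)"
    unfolding free_algebra_simps by (intro sum.cong) (auto simp: word_def)
  then show "(word [] \<otimes>\<^bsub>free_algebra n\<^esub> f) w = f w"
    by simp
  have "(f \<otimes>\<^bsub>free_algebra n\<^esub> word []) w = (\<Sum>i\<le>length w. if i = length w then f w else 0)"
    unfolding free_algebra_simps by (intro sum.cong) (auto simp: word_def)
  then show "(f \<otimes>\<^bsub>free_algebra n\<^esub> word []) w = f w"
    by simp
qed

lemma ring_free_algebra: "ring (free_algebra n)"
proof (rule ringI)
  have add: "f \<oplus>\<^bsub>free_algebra n\<^esub> g \<in> carrier (free_algebra n)"
    if "f \<in> carrier (free_algebra n)" "g \<in> carrier (free_algebra n)" for f g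
  proof -
    have "{w. f w + g w \<noteq> 0} \<subseteq> {w. f w \<noteq> 0} \<union> {w. g w \<noteq> 0}"
      by auto
    with that show ?thesis
      unfolding free_algebra_simps mem_Collect_eq by (meson finite_UnI finite_subset le_sup_iff order_trans)
  qed
  show "abelian_group (free_algebra n)"
  proof (rule abelian_groupI)
    fix f assume "f \<in> carrier (free_algebra n)"
    then show "\<exists>g\<in>carrier (free_algebra n). g \<oplus>\<^bsub>free_algebra n\<^esub> f = \<zero>\<^bsub>free_algebra n\<^esub>"
      by (intro bexI[of _ "\<lambda>w. - f w"]) (auto simp: free_algebra_simps)
  qed (use add in \<open>auto simp: free_algebra_simps ac_simps\<close>)
  show "Group.monoid (free_algebra n)"
  proof (rule monoidI)
    fix f g assume fg: "f \<in> carrier (free_algebra n)" "g \<in> carrier (free_algebra n)"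
    let ?S = "(\<lambda>(u, v). u @ v) ` ({u. f u \<noteq> 0} \<times> {v. g v \<noteq> 0})"
    have "u \<in> lists {1..n}" if "f u \<noteq> 0 \<or> g u \<noteq> 0" for u
      using fg that unfolding free_algebra_simps mem_Collect_eq by blast
    then have "?S \<subseteq> lists {1..n}"
      by force
    moreover have "finite ?S"
      using fg by (simp add: free_algebra_simps)
    moreover note fg
    ultimately have "finite ?S" "?S \<subseteq> lists {1..n}"
      by blast+
    then show "f \<otimes>\<^bsub>free_algebra n\<^esub> g \<in> carrier (free_algebra n)"
      using free_algebra_mult_support[where n = n and f = f and g = g] unfolding free_algebra_simps(1) mem_Collect_eq
      by (meson finite_subset order_trans)
  qed (simp_all only: free_algebra_mult_assoc free_algebra_mult_one free_algebra_simps(3) word_carrier lists.Nil)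
qed (simp_all add: free_algebra_simps sum.distrib algebra_simps)

section \<open>The Clifford algebra\<close>

lemma clifford_relations_carrier: "clifford_relations n \<subseteq> carrier (free_algebra n)"
proof -
  interpret F: ring "free_algebra n" by (rule ring_free_algebra)
  show ?thesis
    by (auto simp: clifford_relations_def intro!: word_carrier)
qed

lemma ideal_clifford_ideal: "ideal (clifford_ideal n) (free_algebra n)"
  unfolding clifford_ideal_def
  by (rule ring.genideal_ideal[OF ring_free_algebra clifford_relations_carrier])

lemma clifford_coset_hom:
  "ring_hom_ring (free_algebra n) (clifford_algebra n) ((+>\<^bsub>free_algebra n\<^esub>) (clifford_ideal n))"
  unfolding clifford_algebra_def by (rule ideal.rcos_ring_hom_ring[OF ideal_clifford_ideal])

text \<open>The coset map is a ring homomorphism, so a product of generators is represented by a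
  single word. Multiplication of such products thereby becomes concatenation.\<close>

lemma clifford_prod_eq_coset:
  assumes "w \<in> lists {1..n}"
  shows "clifford_prod n w = clifford_ideal n +>\<^bsub>free_algebra n\<^esub> word w"
proof -
  interpret h: ring_hom_ring "free_algebra n" "clifford_algebra n" "(+>\<^bsub>free_algebra n\<^esub>) (clifford_ideal n)"
    by (rule clifford_coset_hom)
  show ?thesis
    using assms
  proof (induction w)
    case Nil
    then show ?case
      using h.hom_one by (simp add: clifford_prod_def free_algebra_simps(3))
  next
    case (Cons i w)
    have "clifford_gen n i \<otimes>\<^bsub>clifford_algebra n\<^esub> clifford_prod n w =
        clifford_ideal n +>\<^bsub>free_algebra n\<^esub> (word [i] \<otimes>\<^bsub>free_algebra n\<^esub> word w)"
      using Cons by (simp add: clifford_gen_def word_carrier)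
    then show ?case
      by (simp add: clifford_prod_def word_mult)
  qed
qed

lemma clifford_prod_carrier: "w \<in> lists {1..n} \<Longrightarrow> clifford_prod n w \<in> carrier (clifford_algebra n)"
  using ring_hom_closed[OF ring_hom_ring.homh[OF clifford_coset_hom[of n]] word_carrier[of w n]]
  by (simp add: clifford_prod_eq_coset)

lemma clifford_prod_append:
  assumes "u \<in> lists {1..n}" "v \<in> lists {1..n}"
  shows "clifford_prod n u \<otimes>\<^bsub>clifford_algebra n\<^esub> clifford_prod n v = clifford_prod n (u @ v)"
proof -
  interpret h: ring_hom_ring "free_algebra n" "clifford_algebra n" "(+>\<^bsub>free_algebra n\<^esub>) (clifford_ideal n)"
    by (rule clifford_coset_hom)
  show ?thesis
    using assms by (simp add: clifford_prod_eq_coset word_carrier word_mult flip: h.hom_mult)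
qed

lemma clifford_relation_zero:
  assumes "f \<in> clifford_relations n"
  shows "clifford_ideal n +>\<^bsub>free_algebra n\<^esub> f = \<zero>\<^bsub>clifford_algebra n\<^esub>"
proof -
  interpret I: ideal "clifford_ideal n" "free_algebra n" by (rule ideal_clifford_ideal)
  have "f \<in> clifford_ideal n"
    unfolding clifford_ideal_def using assms I.genideal_self[OF clifford_relations_carrier] by blast
  from I.a_coset_join2[OF I.a_Hcarr[OF this] I.a_subgroup this] show ?thesis
    unfolding clifford_algebra_def by (simp add: FactRing_def)
qed

lemma clifford_gen_square:
  assumes "j \<in> {1..n}"
  shows "clifford_prod n [j, j] = \<ominus>\<^bsub>clifford_algebra n\<^esub> \<one>\<^bsub>clifford_algebra n\<^esub>"
proof -
  interpret h: ring_hom_ring "free_algebra n" "clifford_algebra n" "(+>\<^bsub>free_algebra n\<^esub>) (clifford_ideal n)"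
    by (rule clifford_coset_hom)
  have "word [j, j] \<oplus>\<^bsub>free_algebra n\<^esub> \<one>\<^bsub>free_algebra n\<^esub> \<in> clifford_relations n"
    using assms by (auto simp: clifford_relations_def)
  from clifford_relation_zero[OF this]
  have "clifford_prod n [j, j] \<oplus>\<^bsub>clifford_algebra n\<^esub> \<one>\<^bsub>clifford_algebra n\<^esub> = \<zero>\<^bsub>clifford_algebra n\<^esub>"
    using assms by (simp add: clifford_prod_eq_coset word_carrier)
  from h.S.minus_equality[OF this] show ?thesis
    using assms by (simp add: clifford_prod_carrier)
qed

lemma clifford_gen_anticommute:
  assumes "j \<in> {1..n}" "l \<in> {1..n}" "j \<noteq> l"
  shows "clifford_prod n [j, l] = \<ominus>\<^bsub>clifford_algebra n\<^esub> clifford_prod n [l, j]"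
proof -
  interpret h: ring_hom_ring "free_algebra n" "clifford_algebra n" "(+>\<^bsub>free_algebra n\<^esub>) (clifford_ideal n)"
    by (rule clifford_coset_hom)
  have "word [j, l] \<oplus>\<^bsub>free_algebra n\<^esub> word [l, j] \<in> clifford_relations n"
    unfolding clifford_relations_def using assms by blast
  note this [THEN clifford_relation_zero]
  moreover have "[j, l] \<in> lists {1..n}" "[l, j] \<in> lists {1..n}"
    using assms by simp_all
  ultimately have "clifford_prod n [j, l] \<oplus>\<^bsub>clifford_algebra n\<^esub> clifford_prod n [l, j] = \<zero>\<^bsub>clifford_algebra n\<^esub>"
    by (simp only: clifford_prod_eq_coset word_carrier h.hom_add)
  from h.S.minus_equality[OF this] show ?thesis
    using assms by (simp add: clifford_prod_carrier)
qed

section \<open>Normal form by insertion sort\<close>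

lemma increasing_words_lists: "\<mu> \<in> increasing_words n \<Longrightarrow> \<mu> \<in> lists {1..n}"
  by (auto simp: increasing_words_def)

text \<open>The insertion step. A letter smaller than the head stays in front, a letter equal to the
  head cancels against it up to sign, and a larger letter is moved past the head at the cost of a
  sign. In the last case the head \<open>m\<close> is put back in front of the recursively obtained
  word, which stays increasing because \<open>set \<nu> \<subseteq> insert i (set \<mu>)\<close>;
  the induction carries this bound for that reason.\<close>

lemma clifford_prod_insert:
  assumes "i \<in> {1..n}" "\<mu> \<in> increasing_words n"
  shows "\<exists>\<nu>\<in>increasing_words n. set \<nu> \<subseteq> insert i (set \<mu>) \<and>
    (clifford_prod n (i # \<mu>) = clifford_prod n \<nu> \<or>
     clifford_prod n (i # \<mu>) = \<ominus>\<^bsub>clifford_algebra n\<^esub> clifford_prod n \<nu>)"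
  using assms(2)
proof (induction \<mu>)
  case Nil
  then show ?case
    using assms(1) by (intro bexI[of _ "[i]"]) (auto simp: increasing_words_def)
next
  case (Cons m \<mu>)
  interpret C: ring "clifford_algebra n"
    using clifford_coset_hom by (rule ring_hom_ring.axioms(2))
  have m: "m \<in> {1..n}" and \<mu>: "\<mu> \<in> increasing_words n" "\<forall>x\<in>set \<mu>. m < x"
    using Cons.prems by (auto simp: increasing_words_def)
  note lists = increasing_words_lists[OF \<mu>(1)]
  note split = clifford_prod_append[of "[_, _]" n \<mu>, simplified append.simps]
  note carrier = clifford_prod_carrier[of _ n]
  consider "i < m" | "i = m" | "m < i"
    by linarith
  then show ?case
  proof cases
    case 1
    then show ?thesis
      using assms(1) Cons.prems by (intro bexI[of _ "i # m # \<mu>"]) (auto simp: increasing_words_def)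
  next
    case 2
    have "clifford_prod n (i # i # \<mu>) = clifford_prod n [i, i] \<otimes>\<^bsub>clifford_algebra n\<^esub> clifford_prod n \<mu>"
      using lists assms(1) by (intro split[symmetric]) simp_all
    also have "\<dots> = \<ominus>\<^bsub>clifford_algebra n\<^esub> clifford_prod n \<mu>"
      unfolding clifford_gen_square[OF assms(1)] using carrier[OF lists] by (simp add: C.l_minus)
    finally show ?thesis
      using 2 \<mu>(1) by (intro bexI[of _ \<mu>]) auto
  next
    case 3
    obtain \<nu> where \<nu>: "\<nu> \<in> increasing_words n" "set \<nu> \<subseteq> insert i (set \<mu>)"
      "clifford_prod n (i # \<mu>) = clifford_prod n \<nu> \<or>
       clifford_prod n (i # \<mu>) = \<ominus>\<^bsub>clifford_algebra n\<^esub> clifford_prod n \<nu>"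
      using Cons.IH[OF \<mu>(1)] by blast
    have cons: "clifford_prod n (m # w) = clifford_prod n [m] \<otimes>\<^bsub>clifford_algebra n\<^esub> clifford_prod n w"
      if "w \<in> lists {1..n}" for w
      using clifford_prod_append[of "[m]" n w] that m by simp
    have "clifford_prod n (i # m # \<mu>) = clifford_prod n [i, m] \<otimes>\<^bsub>clifford_algebra n\<^esub> clifford_prod n \<mu>"
      using lists assms(1) m by (intro split[symmetric]) simp_all
    also have "clifford_prod n [i, m] = \<ominus>\<^bsub>clifford_algebra n\<^esub> clifford_prod n [m, i]"
      using 3 assms(1) m by (intro clifford_gen_anticommute) auto
    also have "\<dots> \<otimes>\<^bsub>clifford_algebra n\<^esub> clifford_prod n \<mu> =
        \<ominus>\<^bsub>clifford_algebra n\<^esub> (clifford_prod n [m, i] \<otimes>\<^bsub>clifford_algebra n\<^esub> clifford_prod n \<mu>)"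
      using lists assms(1) m by (intro C.l_minus carrier) simp_all
    also have "clifford_prod n [m, i] \<otimes>\<^bsub>clifford_algebra n\<^esub> clifford_prod n \<mu> = clifford_prod n (m # i # \<mu>)"
      using lists assms(1) m by (intro split) simp_all
    also have "\<dots> = clifford_prod n [m] \<otimes>\<^bsub>clifford_algebra n\<^esub> clifford_prod n (i # \<mu>)"
      using lists assms(1) by (intro cons) simp
    finally have eq: "clifford_prod n (i # m # \<mu>) = \<ominus>\<^bsub>clifford_algebra n\<^esub>
        (clifford_prod n [m] \<otimes>\<^bsub>clifford_algebra n\<^esub> clifford_prod n (i # \<mu>))" .
    have carr: "clifford_prod n [m] \<in> carrier (clifford_algebra n)" "clifford_prod n \<nu> \<in> carrier (clifford_algebra n)"
      using m carrier[of "[m]"] carrier[OF increasing_words_lists[OF \<nu>(1)]] by simp_all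
    have "clifford_prod n (i # m # \<mu>) = clifford_prod n (m # \<nu>) \<or>
        clifford_prod n (i # m # \<mu>) = \<ominus>\<^bsub>clifford_algebra n\<^esub> clifford_prod n (m # \<nu>)"
      using \<nu>(3) carr unfolding eq cons[OF increasing_words_lists[OF \<nu>(1)]] by (auto simp: C.r_minus)
    moreover have "m # \<nu> \<in> increasing_words n"
      using 3 m \<mu>(2) \<nu>(1,2) by (auto simp: increasing_words_def)
    ultimately show ?thesis
      using \<nu>(2) by (intro bexI[of _ "m # \<nu>"]) auto
  qed
qed

lemma clifford_prod_sort:
  assumes "w \<in> lists {1..n}"
  shows "\<exists>\<mu>\<in>increasing_words n. clifford_prod n w = clifford_prod n \<mu> \<or>
    clifford_prod n w = \<ominus>\<^bsub>clifford_algebra n\<^esub> clifford_prod n \<mu>"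
  using assms
proof (induction w)
  case Nil
  then show ?case
    by (intro bexI[of _ "[]"]) (auto simp: increasing_words_def)
next
  case (Cons i w)
  interpret C: ring "clifford_algebra n"
    using clifford_coset_hom by (rule ring_hom_ring.axioms(2))
  obtain \<mu> where \<mu>: "\<mu> \<in> increasing_words n" "clifford_prod n w = clifford_prod n \<mu> \<or>
    clifford_prod n w = \<ominus>\<^bsub>clifford_algebra n\<^esub> clifford_prod n \<mu>"
    using Cons.IH by blast
  have i: "i \<in> {1..n}"
    using Cons.hyps by simp
  obtain \<nu> where \<nu>: "\<nu> \<in> increasing_words n" "clifford_prod n (i # \<mu>) = clifford_prod n \<nu> \<or>
     clifford_prod n (i # \<mu>) = \<ominus>\<^bsub>clifford_algebra n\<^esub> clifford_prod n \<nu>"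
    using clifford_prod_insert[OF i \<mu>(1)] by blast
  have cons: "clifford_prod n (i # v) = clifford_prod n [i] \<otimes>\<^bsub>clifford_algebra n\<^esub> clifford_prod n v"
    if "v \<in> lists {1..n}" for v
    using clifford_prod_append[of "[i]" n v] that i by simp
  have carr: "clifford_prod n v \<in> carrier (clifford_algebra n)" if "v = [i] \<or> v = \<mu> \<or> v = \<nu>" for v
    using that i increasing_words_lists[OF \<mu>(1)] increasing_words_lists[OF \<nu>(1)]
      clifford_prod_carrier[of v n] by auto
  have "clifford_prod n (i # w) = clifford_prod n (i # \<mu>) \<or>
      clifford_prod n (i # w) = \<ominus>\<^bsub>clifford_algebra n\<^esub> clifford_prod n (i # \<mu>)"
    using \<mu>(2) carr unfolding cons[OF increasing_words_lists[OF \<mu>(1)]] cons[OF Cons.hyps(2)]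
    by (auto simp: C.r_minus)
  then show ?case
    using \<nu> carr by (metis C.minus_minus)
qed

text \<open>Sorting changes a product by at most a sign, so the increasing words may be replaced by
  all words. In this form the carrier is visibly closed under multiplication, and a word with
  prescribed phase and mask need not be sorted to give an element.\<close>

lemma Gamma_hat_carrier:
  "carrier (Gamma_hat k) = {x. \<exists>w\<in>lists {1..2 * k}. x = clifford_prod (2 * k) w \<or>
     x = \<ominus>\<^bsub>clifford_algebra (2 * k)\<^esub> clifford_prod (2 * k) w}" (is "?G = ?W")
proof
  show "?G \<subseteq> ?W"
    using increasing_words_lists[of _ "2 * k"] unfolding Gamma_hat_def by fastforce
  interpret C: ring "clifford_algebra (2 * k)"
    using clifford_coset_hom by (rule ring_hom_ring.axioms(2))
  show "?W \<subseteq> ?G"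
  proof
    fix x assume "x \<in> ?W"
    then obtain w where w: "w \<in> lists {1..2 * k}" "x = clifford_prod (2 * k) w \<or>
        x = \<ominus>\<^bsub>clifford_algebra (2 * k)\<^esub> clifford_prod (2 * k) w"
      by blast
    obtain \<mu> where \<mu>: "\<mu> \<in> increasing_words (2 * k)" "clifford_prod (2 * k) w = clifford_prod (2 * k) \<mu> \<or>
        clifford_prod (2 * k) w = \<ominus>\<^bsub>clifford_algebra (2 * k)\<^esub> clifford_prod (2 * k) \<mu>"
      using clifford_prod_sort[OF w(1)] by blast
    have "x = clifford_prod (2 * k) \<mu> \<or> x = \<ominus>\<^bsub>clifford_algebra (2 * k)\<^esub> clifford_prod (2 * k) \<mu>"
      using w(2) \<mu>(2) C.minus_minus[OF clifford_prod_carrier[OF increasing_words_lists[OF \<mu>(1)]]] by metis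
    with \<mu>(1) show "x \<in> ?G"
      unfolding Gamma_hat_def by auto
  qed
qed

lemma Gamma_hat_mult_closed:
  assumes "a \<in> carrier (Gamma_hat k)" "b \<in> carrier (Gamma_hat k)"
  shows "a \<otimes>\<^bsub>Gamma_hat k\<^esub> b \<in> carrier (Gamma_hat k)"
proof -
  let ?C = "clifford_algebra (2 * k)"
  interpret C: ring ?C
    using clifford_coset_hom by (rule ring_hom_ring.axioms(2))
  obtain u v where u: "u \<in> lists {1..2 * k}" and v: "v \<in> lists {1..2 * k}"
    and a: "a = clifford_prod (2 * k) u \<or> a = \<ominus>\<^bsub>?C\<^esub> clifford_prod (2 * k) u"
    and b: "b = clifford_prod (2 * k) v \<or> b = \<ominus>\<^bsub>?C\<^esub> clifford_prod (2 * k) v"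
    using assms unfolding Gamma_hat_carrier by blast
  have "a \<otimes>\<^bsub>?C\<^esub> b = clifford_prod (2 * k) (u @ v) \<or> a \<otimes>\<^bsub>?C\<^esub> b = \<ominus>\<^bsub>?C\<^esub> clifford_prod (2 * k) (u @ v)"
    using a b clifford_prod_carrier[OF u] clifford_prod_carrier[OF v]
    by (auto simp: C.l_minus C.r_minus simp flip: clifford_prod_append[OF u v])
  moreover have "u @ v \<in> lists {1..2 * k}"
    using u v by simp
  moreover have "a \<otimes>\<^bsub>Gamma_hat k\<^esub> b = a \<otimes>\<^bsub>?C\<^esub> b"
    by (simp add: Gamma_hat_def)
  ultimately show ?thesis
    unfolding Gamma_hat_carrier mem_Collect_eq by metis
qed

section \<open>The representation\<close>

lemma rho_word_carrier: "w \<in> lists {1..2 * k} \<Longrightarrow> rho_word k w \<in> carrier_mat (2 ^ k) (2 ^ k)"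
  by (rule xor_monomialD(1)[OF xor_monomial_rho_word])

lemma rho_word_append:
  assumes "u \<in> lists {1..2 * k}" "v \<in> lists {1..2 * k}"
  shows "rho_word k (u @ v) = rho_word k u * rho_word k v"
  using assms(1)
proof (induction u)
  case Nil
  then show ?case
    using rho_word_carrier[OF assms(2)] by (simp add: rho_word_def)
next
  case (Cons i u)
  have "rho_gen k i * (rho_word k u * rho_word k v) = rho_gen k i * rho_word k u * rho_word k v"
    using Cons.hyps by (intro assoc_mult_mat[of _ "2 ^ k" "2 ^ k" _ "2 ^ k" _ "2 ^ k", symmetric] rho_gen_carrier rho_word_carrier assms(2)) simp_all
  with Cons.IH show ?case
    by (simp add: rho_word_def)
qed

section \<open>Linear extension of the representation to the free algebra\<close>

lemma dim_rho_free [simp]: "dim_row (rho_free k f) = 2 ^ k" "dim_col (rho_free k f) = 2 ^ k"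
  by (simp_all add: rho_free_def)

lemma rho_free_carrier: "rho_free k f \<in> carrier_mat (2 ^ k) (2 ^ k)"
  by (simp add: rho_free_def)

text \<open>Cancellation can make the support of a sum or product smaller than expected, so the
  defining sum is extended to any finite set containing the support.\<close>

lemma index_rho_free:
  assumes "finite S" "{w. f w \<noteq> 0} \<subseteq> S" "r < 2 ^ k" "c < 2 ^ k"
  shows "rho_free k f $$ (r, c) = (\<Sum>w\<in>S. f w * rho_word k w $$ (r, c))"
proof -
  have "(\<Sum>w | f w \<noteq> 0. f w * rho_word k w $$ (r, c)) = (\<Sum>w\<in>S. f w * rho_word k w $$ (r, c))"
    using assms(1,2) by (intro sum.mono_neutral_left) auto
  with assms show ?thesis
    by (simp add: rho_free_def)
qed

lemma rho_free_word:
  assumes "w \<in> lists {1..2 * k}"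
  shows "rho_free k (word w) = rho_word k w"
proof (rule eq_matI)
  fix r c assume "r < dim_row (rho_word k w)" "c < dim_col (rho_word k w)"
  then show "rho_free k (word w) $$ (r, c) = rho_word k w $$ (r, c)"
    using rho_word_carrier[OF assms] by (subst index_rho_free[of "{w}"]) (auto simp: word_def)
qed (use rho_free_carrier[of k "word w"] rho_word_carrier[OF assms] in auto)

lemma rho_free_add:
  assumes "f \<in> carrier (free_algebra n)" "g \<in> carrier (free_algebra n)"
  shows "rho_free k (f \<oplus>\<^bsub>free_algebra n\<^esub> g) = rho_free k f + rho_free k g"
proof (rule eq_matI)
  fix r c assume "r < dim_row (rho_free k f + rho_free k g)" "c < dim_col (rho_free k f + rho_free k g)"
  then have rc: "r < 2 ^ k" "c < 2 ^ k"
    using rho_free_carrier[of k g] by simp_all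
  have S: "finite ({w. f w \<noteq> 0} \<union> {w. g w \<noteq> 0})"
    using assms by (simp add: free_algebra_simps)
  have "{w. (f \<oplus>\<^bsub>free_algebra n\<^esub> g) w \<noteq> 0} \<subseteq> {w. f w \<noteq> 0} \<union> {w. g w \<noteq> 0}"
    by (auto simp: free_algebra_simps)
  from index_rho_free[OF S this rc] rc
  show "rho_free k (f \<oplus>\<^bsub>free_algebra n\<^esub> g) $$ (r, c) = (rho_free k f + rho_free k g) $$ (r, c)"
    by (simp add: index_rho_free[OF S] free_algebra_simps(5) algebra_simps sum.distrib)
qed simp_all

lemma rho_free_mult:
  assumes f: "f \<in> carrier (free_algebra (2 * k))" and g: "g \<in> carrier (free_algebra (2 * k))"
  shows "rho_free k (f \<otimes>\<^bsub>free_algebra (2 * k)\<^esub> g) = rho_free k f * rho_free k g"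
proof (rule eq_matI)
  fix r c assume "r < dim_row (rho_free k f * rho_free k g)" "c < dim_col (rho_free k f * rho_free k g)"
  then have rc: "r < 2 ^ k" "c < 2 ^ k"
    using rho_free_carrier[of k f] rho_free_carrier[of k g] by simp_all
  define A where "A = {w. f w \<noteq> 0}"
  define B where "B = {w. g w \<noteq> 0}"
  have A: "finite A" "A \<subseteq> lists {1..2 * k}" and B: "finite B" "B \<subseteq> lists {1..2 * k}"
    using f g by (simp_all add: free_algebra_simps A_def B_def)
  define S where "S = (\<lambda>(u, v). u @ v) ` (A \<times> B)"
  have S: "finite S" "{w. (f \<otimes>\<^bsub>free_algebra (2 * k)\<^esub> g) w \<noteq> 0} \<subseteq> S"
    using A B free_algebra_mult_support[of _ f g] by (auto simp: S_def A_def B_def)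
  have append_in_S: "u @ v \<in> S" if "f u \<noteq> 0" "g v \<noteq> 0" for u v
    using that by (force simp: S_def A_def B_def)
  let ?R = "\<lambda>w. rho_word k w $$ (r, c)"
  have "rho_free k (f \<otimes>\<^bsub>free_algebra (2 * k)\<^esub> g) $$ (r, c) =
      (\<Sum>w\<in>S. \<Sum>i\<le>length w. f (take i w) * g (drop i w) * ?R w)"
    unfolding index_rho_free[OF S rc] by (simp add: free_algebra_simps(2) sum_distrib_right)
  also have "\<dots> = (\<Sum>(w, i)\<in>Sigma S (\<lambda>w. {..length w}). f (take i w) * g (drop i w) * ?R w)"
    using S by (simp add: sum.Sigma)
  also have "\<dots> = (\<Sum>(u, v)\<in>A \<times> B. f u * g v * ?R (u @ v))"
  \<comment> \<open>A word \<open>w\<close> with a cut position \<open>i\<close> corresponds to its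
    two pieces. The exceptional set consists of the cuts where \<open>f\<close> or \<open>g\<close>
    vanishes on its piece; these contribute zero and have no partner in
    \<open>A \<times> B\<close>.\<close>
  proof (rule sum.reindex_bij_witness_not_neutral[of
        "{(w, i). w \<in> S \<and> i \<le> length w \<and> (f (take i w) = 0 \<or> g (drop i w) = 0)}" "{}" _
        "\<lambda>(u, v). (u @ v, length u)" "\<lambda>(w, i). (take i w, drop i w)"])
    have "{(w, i). w \<in> S \<and> i \<le> length w \<and> (f (take i w) = 0 \<or> g (drop i w) = 0)} \<subseteq>
        Sigma S (\<lambda>w. {..length w})"
      by blast
    then show "finite {(w, i). w \<in> S \<and> i \<le> length w \<and> (f (take i w) = 0 \<or> g (drop i w) = 0)}"
      by (rule finite_subset) (simp add: S)
  qed (auto simp: A_def B_def append_in_S)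
  also have "\<dots> = (\<Sum>u\<in>A. \<Sum>v\<in>B. \<Sum>x<2 ^ k. f u * g v * (rho_word k u $$ (r, x) * rho_word k v $$ (x, c)))"
    unfolding sum.cartesian_product[symmetric]
  proof (intro sum.cong refl)
    fix u v assume "u \<in> A" "v \<in> B"
    then have uv: "u \<in> lists {1..2 * k}" "v \<in> lists {1..2 * k}"
      using A B by blast+
    show "f u * g v * ?R (u @ v) =
        (\<Sum>x<2 ^ k. f u * g v * (rho_word k u $$ (r, x) * rho_word k v $$ (x, c)))"
      using rc rho_word_carrier[OF uv(1)] rho_word_carrier[OF uv(2)]
      by (simp add: rho_word_append[OF uv] scalar_prod_def sum_distrib_left flip: lessThan_atLeast0)
  qed
  also have "\<dots> = (\<Sum>u\<in>A. \<Sum>x<2 ^ k. \<Sum>v\<in>B. f u * g v * (rho_word k u $$ (r, x) * rho_word k v $$ (x, c)))"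
    by (intro sum.cong refl sum.swap)
  also have "\<dots> = (\<Sum>x<2 ^ k. \<Sum>u\<in>A. \<Sum>v\<in>B. f u * g v * (rho_word k u $$ (r, x) * rho_word k v $$ (x, c)))"
    by (rule sum.swap)
  also have "\<dots> = (\<Sum>x<2 ^ k. (\<Sum>u\<in>A. f u * rho_word k u $$ (r, x)) * (\<Sum>v\<in>B. g v * rho_word k v $$ (x, c)))"
    by (simp add: sum_product ac_simps)
  also have "\<dots> = (\<Sum>x<2 ^ k. rho_free k f $$ (r, x) * rho_free k g $$ (x, c))"
    using rc by (simp add: rho_free_def A_def B_def)
  also have "\<dots> = (rho_free k f * rho_free k g) $$ (r, c)"
    using rc rho_free_carrier[of k f] rho_free_carrier[of k g]
    by (simp add: scalar_prod_def flip: lessThan_atLeast0)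
  finally show "rho_free k (f \<otimes>\<^bsub>free_algebra (2 * k)\<^esub> g) $$ (r, c) = (rho_free k f * rho_free k g) $$ (r, c)" .
qed simp_all

lemma rho_free_hom:
  "ring_hom_ring (free_algebra (2 * k)) (ring_mat TYPE(complex) (2 ^ k) ()) (rho_free k)"
proof (rule ring_hom_ringI[OF ring_free_algebra ring_mat])
  show "rho_free k \<one>\<^bsub>free_algebra (2 * k)\<^esub> = \<one>\<^bsub>ring_mat TYPE(complex) (2 ^ k) ()\<^esub>"
    by (simp add: free_algebra_simps(3) rho_free_word rho_word_def ring_mat_simps)
qed (simp_all add: ring_mat_simps rho_free_carrier rho_free_add rho_free_mult)

section \<open>Descent of the representation to the Clifford algebra\<close>

lemma clifford_ideal_subset_kernel:
  "clifford_ideal (2 * k) \<subseteq>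
     a_kernel (free_algebra (2 * k)) (ring_mat TYPE(complex) (2 ^ k) ()) (rho_free k)"
proof -
  interpret h: ring_hom_ring "free_algebra (2 * k)" "ring_mat TYPE(complex) (2 ^ k) ()" "rho_free k"
    by (rule rho_free_hom)
  have lists: "[i, j] \<in> lists {1..2 * k}" if "i \<in> {1..2 * k}" "j \<in> {1..2 * k}" for i j
    using that by simp
  have one: "\<one>\<^bsub>free_algebra (2 * k)\<^esub> = word []" "[] \<in> lists {1..2 * k}"
    by (simp_all add: free_algebra_simps)
  have rho2: "rho_free k (word [i, j]) = rho_gen k i * rho_gen k j"
    if "i \<in> {1..2 * k}" "j \<in> {1..2 * k}" for i j
    using rho_free_word[OF lists[OF that]] rho_gen_carrier[OF that(2)] by (simp add: rho_word_def)
  have carrier: "rho_gen k i * rho_gen k j \<in> carrier_mat (2 ^ k) (2 ^ k)"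
    if "i \<in> {1..2 * k}" "j \<in> {1..2 * k}" for i j
    using that by (intro mult_carrier_mat[of _ _ "2 ^ k"] rho_gen_carrier)
  have "rho_free k (word [j, j] \<oplus>\<^bsub>free_algebra (2 * k)\<^esub> \<one>\<^bsub>free_algebra (2 * k)\<^esub>) = 0\<^sub>m (2 ^ k) (2 ^ k)"
    if "j \<in> {1..2 * k}" for j
    using that lists[OF that that] rho_free_word[OF one(2)]
    by (simp only: one rho_free_add[of _ "2 * k"] word_carrier rho2 rho_gen_relations(1))
      (simp add: rho_word_def)
  moreover have "rho_free k (word [j, l] \<oplus>\<^bsub>free_algebra (2 * k)\<^esub> word [l, j]) = 0\<^sub>m (2 ^ k) (2 ^ k)"
    if "j \<in> {1..2 * k}" "l \<in> {1..2 * k}" "j \<noteq> l" for j l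
    using uminus_l_inv_mat[OF carrier[OF that(2,1)]] rho_gen_relations(3)[OF that]
      rho_free_add[OF word_carrier[OF lists[OF that(1,2)]] word_carrier[OF lists[OF that(2,1)]], of k]
    by (simp only: rho2 that)
  \<comment> \<open>The kernel is an ideal, so it contains the generated ideal once it contains the
    relations.\<close>
  ultimately have "clifford_relations (2 * k) \<subseteq>
      a_kernel (free_algebra (2 * k)) (ring_mat TYPE(complex) (2 ^ k) ()) (rho_free k)"
    using clifford_relations_carrier[of "2 * k"]
    unfolding a_kernel_def' clifford_relations_def ring_mat_simps by blast
  then show ?thesis
    unfolding clifford_ideal_def by (rule h.R.genideal_minimal[OF h.kernel_is_ideal])
qed

text \<open>The image of the coset under \<open>rho_free\<close> is a singleton: it is constant
  since the ideal lies in the kernel, and nonempty since \<open>f\<close> is in its own coset. This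
  gives \<open>the_elem\<close> in the definition of \<open>rho\<close> its value.\<close>

lemma rho_coset:
  assumes "f \<in> carrier (free_algebra (2 * k))"
  shows "rho k (clifford_ideal (2 * k) +>\<^bsub>free_algebra (2 * k)\<^esub> f) = rho_free k f"
proof -
  interpret h: ring_hom_ring "free_algebra (2 * k)" "ring_mat TYPE(complex) (2 ^ k) ()" "rho_free k"
    by (rule rho_free_hom)
  interpret I: ideal "clifford_ideal (2 * k)" "free_algebra (2 * k)"
    by (rule ideal_clifford_ideal)
  have "rho_free k x = rho_free k f" if "x \<in> clifford_ideal (2 * k) +>\<^bsub>free_algebra (2 * k)\<^esub> f" for x
    using that clifford_ideal_subset_kernel[of k] assms
    by (intro h.rcos_imp_homeq) (auto simp: a_r_coset_def')
  moreover have "f \<in> clifford_ideal (2 * k) +>\<^bsub>free_algebra (2 * k)\<^esub> f"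
    by (rule I.a_rcos_self[OF assms])
  ultimately have "rho_free k ` (clifford_ideal (2 * k) +>\<^bsub>free_algebra (2 * k)\<^esub> f) = {rho_free k f}"
    by blast
  then show ?thesis
    by (simp add: rho_def)
qed

lemma rho_clifford_prod:
  assumes "w \<in> lists {1..2 * k}"
  shows "rho k (clifford_prod (2 * k) w) = rho_word k w"
    and "rho k (\<ominus>\<^bsub>clifford_algebra (2 * k)\<^esub> clifford_prod (2 * k) w) = - rho_word k w"
proof -
  interpret h: ring_hom_ring "free_algebra (2 * k)" "ring_mat TYPE(complex) (2 ^ k) ()" "rho_free k"
    by (rule rho_free_hom)
  interpret c: ring_hom_ring "free_algebra (2 * k)" "clifford_algebra (2 * k)"
    "(+>\<^bsub>free_algebra (2 * k)\<^esub>) (clifford_ideal (2 * k))"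
    by (rule clifford_coset_hom)
  note word = word_carrier[OF assms]
  show "rho k (clifford_prod (2 * k) w) = rho_word k w"
    by (simp only: clifford_prod_eq_coset[OF assms] rho_coset[OF word] rho_free_word[OF assms])
  have "\<ominus>\<^bsub>clifford_algebra (2 * k)\<^esub> clifford_prod (2 * k) w =
      clifford_ideal (2 * k) +>\<^bsub>free_algebra (2 * k)\<^esub> (\<ominus>\<^bsub>free_algebra (2 * k)\<^esub> word w)"
    by (simp only: clifford_prod_eq_coset[OF assms] c.hom_a_inv[OF word])
  then have "rho k (\<ominus>\<^bsub>clifford_algebra (2 * k)\<^esub> clifford_prod (2 * k) w) =
      \<ominus>\<^bsub>ring_mat TYPE(complex) (2 ^ k) ()\<^esub> rho_word k w"
    using rho_coset[OF h.R.a_inv_closed[OF word]] h.hom_a_inv[OF word] rho_free_word[OF assms] by simp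
  also have "\<dots> = - rho_word k w"
    using rho_word_carrier[OF assms]
    by (intro h.S.minus_equality) (simp_all add: ring_mat_simps)
  finally show "rho k (\<ominus>\<^bsub>clifford_algebra (2 * k)\<^esub> clifford_prod (2 * k) w) = - rho_word k w" .
qed

lemma rho_mult:
  assumes "a \<in> carrier (clifford_algebra (2 * k))" "b \<in> carrier (clifford_algebra (2 * k))"
  shows "rho k (a \<otimes>\<^bsub>clifford_algebra (2 * k)\<^esub> b) = rho k a * rho k b"
proof -
  interpret c: ring_hom_ring "free_algebra (2 * k)" "clifford_algebra (2 * k)"
    "(+>\<^bsub>free_algebra (2 * k)\<^esub>) (clifford_ideal (2 * k))"
    by (rule clifford_coset_hom)
  obtain f g where f: "f \<in> carrier (free_algebra (2 * k))" "a = clifford_ideal (2 * k) +>\<^bsub>free_algebra (2 * k)\<^esub> f"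
    and g: "g \<in> carrier (free_algebra (2 * k))" "b = clifford_ideal (2 * k) +>\<^bsub>free_algebra (2 * k)\<^esub> g"
    using assms unfolding clifford_algebra_def FactRing_def A_RCOSETS_def' by auto
  show ?thesis
    using rho_coset[OF c.R.m_closed[OF f(1) g(1)]] rho_free_mult[OF f(1) g(1)]
    by (simp only: f g c.hom_mult rho_coset)
qed

lemma Gamma_hat_subset: "carrier (Gamma_hat k) \<subseteq> carrier (clifford_algebra (2 * k))"
proof -
  interpret C: ring "clifford_algebra (2 * k)"
    using clifford_coset_hom by (rule ring_hom_ring.axioms(2))
  show ?thesis
    using clifford_prod_carrier[of _ "2 * k"] unfolding Gamma_hat_carrier by blast
qed

lemma Gamma_hat_xor_monomial:
  assumes "a \<in> carrier (Gamma_hat k)"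
  shows "\<exists>t m. xor_monomial k t m (rho k a)"
proof -
  obtain w where w: "w \<in> lists {1..2 * k}" "a = clifford_prod (2 * k) w \<or>
      a = \<ominus>\<^bsub>clifford_algebra (2 * k)\<^esub> clifford_prod (2 * k) w"
    using assms unfolding Gamma_hat_carrier by blast
  then have "xor_monomial k (word_phase w) (word_mask w) (rho k a)"
    using xor_monomial_rho_word[OF w(1)] xor_monomial_uminus
    by (elim disjE) (simp_all only: rho_clifford_prod[OF w(1)])
  then show ?thesis
    by blast
qed

lemma rho_Gamma_hat_xor_monomial:
  "M \<in> carrier (rho_Gamma_hat k) \<Longrightarrow> \<exists>t m. xor_monomial k t m M"
  using Gamma_hat_xor_monomial by (auto simp: rho_Gamma_hat_def)

section \<open>Quotients by the fibres of a homomorphism\<close>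

text \<open>The classes of \<open>r\<close> are the fibres of \<open>h\<close>, and sending
  \<open>y\<close> to its fibre is a bijective homomorphism from \<open>H\<close>. The group laws of
  the quotient are transported from \<open>H\<close> along it, with \<open>G\<close> contributing
  closure and the unit.\<close>

lemma quotient_group_fibres:
  assumes H: "group H" and h: "h \<in> hom G H" and surj: "h ` carrier G = carrier H"
    and closed: "\<And>a b. a \<in> carrier G \<Longrightarrow> b \<in> carrier G \<Longrightarrow> a \<otimes>\<^bsub>G\<^esub> b \<in> carrier G"
    and one: "\<one>\<^bsub>G\<^esub> \<in> carrier G" "h \<one>\<^bsub>G\<^esub> = \<one>\<^bsub>H\<^esub>"
    and r: "r = {(a, b). a \<in> carrier G \<and> b \<in> carrier G \<and> h a = h b}"
  shows "group (quotient_group G r)" and "quotient_group G r \<cong> H"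
proof -
  interpret H: group H by (rule H)
  let ?Q = "quotient_group G r"
  define f where "f y = {a \<in> carrier G. h a = y}" for y
  have r_image: "r `` {a} = f (h a)" if "a \<in> carrier G" for a
    using that by (auto simp: r f_def)
  have carrier: "carrier ?Q = f ` carrier H"
    using r_image by (auto simp: quotient_group_def quotient_def surj[symmetric])
  have "f \<in> hom H ?Q"
  proof (rule homI)
    fix y z assume y: "y \<in> carrier H" and z: "z \<in> carrier H"
    have "r `` {a \<otimes>\<^bsub>G\<^esub> b} = f (y \<otimes>\<^bsub>H\<^esub> z)" if "a \<in> f y" "b \<in> f z" for a b
      using that r_image[OF closed] hom_mult[OF h] by (auto simp: f_def)
    \<comment> \<open>The product of two classes is a union over representatives of one constant
      set; it equals that set because the index sets are nonempty.\<close>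
    moreover have "f y \<noteq> {}" "f z \<noteq> {}"
      using y z by (auto simp: f_def surj[symmetric])
    ultimately show "f (y \<otimes>\<^bsub>H\<^esub> z) = f y \<otimes>\<^bsub>?Q\<^esub> f z"
      by (auto simp: quotient_group_def)
  qed (simp add: carrier)
  \<comment> \<open>The image of a group under a homomorphism is a group with the image of the unit
    as its unit; this identifies that structure with the quotient.\<close>
  moreover have "?Q\<lparr>carrier := f ` carrier H, one := f \<one>\<^bsub>H\<^esub>\<rparr> = ?Q"
    using r_image[OF one(1)] one(2) by (simp add: carrier[symmetric] quotient_group_def)
  ultimately show "group ?Q"
    using H.hom_imp_img_group by metis
  have "inj_on f (carrier H)"
    by (rule inj_onI) (auto simp: f_def surj[symmetric])
  then have "f \<in> iso H ?Q"
    using \<open>f \<in> hom H ?Q\<close> carrier by (simp add: iso_def bij_betw_def)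
  then show "?Q \<cong> H"
    by (metis H.iso_sym is_isoI)
qed

section \<open>The action on the 2-torsion\<close>

lemma abelian_group_module_vec: "abelian_group (module_vec TYPE('a :: comm_ring_1) n)"
proof (rule abelian_groupI)
  fix x :: "'a vec" assume "x \<in> carrier (module_vec TYPE('a) n)"
  then show "\<exists>y\<in>carrier (module_vec TYPE('a) n). y \<oplus>\<^bsub>module_vec TYPE('a) n\<^esub> x = \<zero>\<^bsub>module_vec TYPE('a) n\<^esub>"
    by (intro bexI[of _ "- x"]) (simp_all add: module_vec_simps)
qed (auto simp: module_vec_simps intro: comm_add_vec)

lemma a_inv_module_vec:
  assumes "x \<in> carrier_vec n"
  shows "\<ominus>\<^bsub>module_vec TYPE('a :: comm_ring_1) n\<^esub> x = - x"
proof -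
  interpret V: abelian_group "module_vec TYPE('a) n" by (rule abelian_group_module_vec)
  show ?thesis
    using assms by (intro V.minus_equality) (simp_all add: module_vec_simps)
qed

lemma abelian_subgroup_gauss_lattice:
  "abelian_subgroup (gauss_lattice n) (module_vec TYPE(complex) n)"
proof (rule abelian_subgroupI3[OF _ abelian_group_module_vec])
  interpret V: abelian_group "module_vec TYPE(complex) n" by (rule abelian_group_module_vec)
  show "additive_subgroup (gauss_lattice n) (module_vec TYPE(complex) n)"
  proof (rule additive_subgroup.intro, rule V.add.subgroupI)
    show "gauss_lattice n \<noteq> {}"
      by (auto simp: gauss_lattice_def intro!: exI[of _ "0\<^sub>v n"])
  next
    fix x assume x: "x \<in> gauss_lattice n"
    then have "\<ominus>\<^bsub>module_vec TYPE(complex) n\<^esub> x = - x"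
      by (intro a_inv_module_vec) (simp add: gauss_lattice_def)
    with x show "\<ominus>\<^bsub>module_vec TYPE(complex) n\<^esub> x \<in> gauss_lattice n"
      by (auto simp: gauss_lattice_def)
  qed (auto simp: gauss_lattice_def module_vec_simps)
qed

section \<open>Lattice cosets and half lattice points\<close>

abbreviation torus_coset :: "nat \<Rightarrow> complex vec \<Rightarrow> complex vec set" where
  "torus_coset k v \<equiv> gauss_lattice (2 ^ k) +>\<^bsub>module_vec TYPE(complex) (2 ^ k)\<^esub> v"

lemma torus_coset_eq_iff:
  assumes "u \<in> carrier_vec (2 ^ k)" "v \<in> carrier_vec (2 ^ k)"
  shows "torus_coset k u = torus_coset k v \<longleftrightarrow> u - v \<in> gauss_lattice (2 ^ k)"
proof -
  let ?V = "module_vec TYPE(complex) (2 ^ k)"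
  interpret L: abelian_subgroup "gauss_lattice (2 ^ k)" ?V
    by (rule abelian_subgroup_gauss_lattice)
  have carr: "u \<in> carrier ?V" "v \<in> carrier ?V"
    using assms by (simp_all add: module_vec_simps)
  have "torus_coset k u = torus_coset k v \<longleftrightarrow> u \<in> torus_coset k v"
    using L.a_repr_independence[OF _ carr(2) L.a_subgroup] L.a_rcos_self[OF carr(1)] by blast
  also have "\<dots> \<longleftrightarrow> u \<oplus>\<^bsub>?V\<^esub> \<ominus>\<^bsub>?V\<^esub> v \<in> gauss_lattice (2 ^ k)"
    by (rule L.a_rcos_module[OF carr(2,1)])
  also have "u \<oplus>\<^bsub>?V\<^esub> \<ominus>\<^bsub>?V\<^esub> v = u - v"
    using assms by (auto simp: a_inv_module_vec module_vec_simps)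
  finally show ?thesis .
qed

lemma J2_eq: "J2 k = torus_coset k ` {v \<in> carrier_vec (2 ^ k). v + v \<in> gauss_lattice (2 ^ k)}"
proof -
  let ?V = "module_vec TYPE(complex) (2 ^ k)"
  interpret L: abelian_subgroup "gauss_lattice (2 ^ k)" ?V
    by (rule abelian_subgroup_gauss_lattice)
  have "torus_coset k v \<otimes>\<^bsub>torus k\<^esub> torus_coset k v = \<one>\<^bsub>torus k\<^esub> \<longleftrightarrow> v + v \<in> gauss_lattice (2 ^ k)"
    if "v \<in> carrier_vec (2 ^ k)" for v
  proof -
    have carr: "v \<in> carrier ?V" "v \<oplus>\<^bsub>?V\<^esub> v \<in> carrier ?V"
      using that by (simp_all add: module_vec_simps)
    have "torus_coset k v \<otimes>\<^bsub>torus k\<^esub> torus_coset k v = torus_coset k (v \<oplus>\<^bsub>?V\<^esub> v)"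
      using L.a_rcos_sum[OF carr(1,1)] by (simp add: torus_def)
    moreover have "torus_coset k (v \<oplus>\<^bsub>?V\<^esub> v) = gauss_lattice (2 ^ k) \<longleftrightarrow> v \<oplus>\<^bsub>?V\<^esub> v \<in> gauss_lattice (2 ^ k)"
      using L.a_coset_join2[OF carr(2) L.a_subgroup] L.a_rcos_self[OF carr(2)] by blast
    ultimately show ?thesis
      by (simp add: torus_def A_FactGroup_def' module_vec_simps)
  qed
  moreover have "carrier (torus k) = torus_coset k ` carrier_vec (2 ^ k)"
    by (auto simp: torus_def A_FactGroup_def' A_RCOSETS_def' module_vec_simps)
  ultimately show ?thesis
    by (auto simp: J2_def)
qed

section \<open>Monomial matrices acting on the torus\<close>

lemma unit_square_cases:
  fixes e :: complex
  assumes "e\<^sup>2 = (-1) ^ t"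
  shows "if even t then e = 1 \<or> e = -1 else e = \<i> \<or> e = - \<i>"
proof (cases "even t")
  case True
  with assms show ?thesis by (simp add: power2_eq_1_iff)
next
  case False
  with assms have "e\<^sup>2 = \<i>\<^sup>2" by simp
  then show ?thesis
    using False by (simp only: power2_eq_iff if_False)
qed

lemma unit_mult_gauss:
  fixes e z :: complex
  assumes "e\<^sup>2 = (-1) ^ t" "Re z \<in> \<int>" "Im z \<in> \<int>"
  shows "Re (e * z) \<in> \<int>" "Im (e * z) \<in> \<int>"
  using unit_square_cases[OF assms(1)] assms(2,3) by (auto split: if_splits)

text \<open>Since xor with \<open>m\<close> is an involution, the nonzero entry of row
  \<open>r\<close> sits in column \<open>r XOR m\<close>.\<close>

lemma xor_monomial_mult_vec:
  assumes M: "xor_monomial a t m M" and v: "v \<in> carrier_vec (2 ^ a)" and r: "r < 2 ^ a"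
  shows "(M *\<^sub>v v) $ r = M $$ (r, r XOR m) * v $ (r XOR m)"
proof -
  have "M $$ (r, c) = 0" if "c < 2 ^ a" "c \<noteq> r XOR m" for c
    using xor_monomialD(5)[OF M r that(1)] that(2) by (auto simp: eq_xor_iff)
  then have "(\<Sum>c<2 ^ a. M $$ (r, c) * v $ c) = (\<Sum>c<2 ^ a. if c = r XOR m then M $$ (r, c) * v $ c else 0)"
    by (intro sum.cong) auto
  moreover have "r XOR m < 2 ^ a"
    using r xor_monomialD(4)[OF M] by (rule xor_less_power2)
  ultimately show ?thesis
    using xor_monomialD[OF M] v r by (simp add: scalar_prod_def flip: lessThan_atLeast0)
qed

lemma xor_monomial_entry:
  assumes "xor_monomial a t m M" "r < 2 ^ a"
  shows "(M $$ (r, r XOR m))\<^sup>2 = (-1) ^ t"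
  using xor_monomialD(5)[OF assms(1,2) xor_less_power2[OF assms(2) xor_monomialD(4)[OF assms(1)]]]
  by (simp add: xor_cancel)

lemma xor_monomial_gauss_lattice:
  assumes M: "xor_monomial a t m M" and v: "v \<in> gauss_lattice (2 ^ a)"
  shows "M *\<^sub>v v \<in> gauss_lattice (2 ^ a)"
proof -
  have carr: "v \<in> carrier_vec (2 ^ a)"
    using v by (simp add: gauss_lattice_def)
  have "Re ((M *\<^sub>v v) $ r) \<in> \<int> \<and> Im ((M *\<^sub>v v) $ r) \<in> \<int>" if r: "r < 2 ^ a" for r
  proof -
    have "r XOR m < 2 ^ a"
      using r xor_monomialD(4)[OF M] by (rule xor_less_power2)
    then show ?thesis
      using unit_mult_gauss[OF xor_monomial_entry[OF M r]] v
      unfolding xor_monomial_mult_vec[OF M carr r] gauss_lattice_def by blast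
  qed
  then show ?thesis
    using mult_mat_vec_carrier[OF xor_monomialD(1)[OF M] carr] by (simp add: gauss_lattice_def)
qed

lemma torus_act_coset:
  assumes M: "xor_monomial k t m M" and v: "v \<in> carrier_vec (2 ^ k)"
  shows "torus_act k M (torus_coset k v) = torus_coset k (M *\<^sub>v v)"
proof -
  interpret L: abelian_subgroup "gauss_lattice (2 ^ k)" "module_vec TYPE(complex) (2 ^ k)"
    by (rule abelian_subgroup_gauss_lattice)
  note Mc = xor_monomialD(1)[OF M]
  have "torus_coset k (M *\<^sub>v u) = torus_coset k (M *\<^sub>v v)" if u: "u \<in> torus_coset k v" for u
  proof -
    obtain l where l: "l \<in> gauss_lattice (2 ^ k)" "u = l + v"
      using u by (auto simp: a_r_coset_def' module_vec_simps)
    then have lc: "l \<in> carrier_vec (2 ^ k)"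
      by (simp add: gauss_lattice_def)
    have "M *\<^sub>v u = M *\<^sub>v l + M *\<^sub>v v"
      unfolding l(2) by (rule mult_add_distrib_mat_vec[OF Mc lc v])
    moreover have "M *\<^sub>v l + M *\<^sub>v v - M *\<^sub>v v = M *\<^sub>v l"
      using mult_mat_vec_carrier[OF Mc lc] mult_mat_vec_carrier[OF Mc v] by auto
    ultimately show ?thesis
      using xor_monomial_gauss_lattice[OF M l(1)] mult_mat_vec_carrier[OF Mc lc] mult_mat_vec_carrier[OF Mc v]
      by (simp add: torus_coset_eq_iff)
  qed
  moreover have "v \<in> torus_coset k v"
    using v by (intro L.a_rcos_self) (simp add: module_vec_simps)
  ultimately show ?thesis
    unfolding torus_act_def by blast
qed

lemma half_not_Ints: "(1 / 2 :: real) \<notin> \<int>" "(- 1 / 2 :: real) \<notin> \<int>"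
proof -
  show "(1 / 2 :: real) \<notin> \<int>"
  proof
    assume "(1 / 2 :: real) \<in> \<int>"
    then obtain z where "(1 / 2 :: real) = of_int z"
      by (rule Ints_cases)
    then have "of_int (2 * z) = (of_int 1 :: real)"
      by simp
    then have "2 * z = 1"
      by (simp only: of_int_eq_iff)
    then show False
      by presburger
  qed
  then show "(- 1 / 2 :: real) \<notin> \<int>"
    using Ints_minus[of "- 1 / 2 :: real"] by auto
qed

text \<open>Half of the first unit vector already detects both \<open>m\<close> and \<open>t mod 2\<close>; conversely
  \<open>e z - (-e) z = e (z + z)\<close> is a lattice point whenever \<open>z + z\<close> is one.\<close>

lemma torus_act_eq_iff:
  assumes M: "xor_monomial k s m M" and N: "xor_monomial k t n N"
  shows "(\<forall>x\<in>J2 k. torus_act k M x = torus_act k N x) \<longleftrightarrow> m = n \<and> even s = even t"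
proof -
  let ?P = "\<lambda>v. M *\<^sub>v v - N *\<^sub>v v \<in> gauss_lattice (2 ^ k)"
  have act: "torus_act k M (torus_coset k v) = torus_act k N (torus_coset k v) \<longleftrightarrow> ?P v"
    if "v \<in> carrier_vec (2 ^ k)" for v
    using mult_mat_vec_carrier[OF xor_monomialD(1)[OF M] that]
      mult_mat_vec_carrier[OF xor_monomialD(1)[OF N] that]
    by (simp add: torus_act_coset[OF M that] torus_act_coset[OF N that] torus_coset_eq_iff)
  have diff: "(M *\<^sub>v v - N *\<^sub>v v) $ r = M $$ (r, r XOR m) * v $ (r XOR m) - N $$ (r, r XOR n) * v $ (r XOR n)"
    if "v \<in> carrier_vec (2 ^ k)" "r < 2 ^ k" for v r
    using that xor_monomialD(2)[OF N]
    by (simp add: xor_monomial_mult_vec[OF M that] xor_monomial_mult_vec[OF N that] del: index_mult_mat_vec)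
  show ?thesis
  proof
    assume *: "\<forall>x\<in>J2 k. torus_act k M x = torus_act k N x"
    define v :: "complex vec" where "v = vec (2 ^ k) (\<lambda>i. if i = 0 then 1 / 2 else 0)"
    have v: "v \<in> carrier_vec (2 ^ k)" "v + v \<in> gauss_lattice (2 ^ k)"
      by (auto simp: v_def gauss_lattice_def)
    then have "?P v"
      using * act[OF v(1)] unfolding J2_eq by blast
    note mn = xor_monomialD(4)[OF M] xor_monomialD(4)[OF N]
    define e where "e = M $$ (m, 0)"
    \<comment> \<open>Row \<open>m\<close> of \<open>N\<close> reads coordinate
      \<open>m XOR n\<close> of \<open>v\<close>, which is the nonzero coordinate 0 exactly when
      \<open>m = n\<close>.\<close>
    define e' where "e' = N $$ (m, m XOR n)"
    have e: "e\<^sup>2 = (-1) ^ s" "e'\<^sup>2 = (-1) ^ t"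
      using xor_monomial_entry[OF M mn(1)] xor_monomial_entry[OF N mn(1)] by (simp_all add: e_def e'_def)
    have "(M *\<^sub>v v - N *\<^sub>v v) $ m = e / 2 - (if m = n then e' / 2 else 0)"
    proof -
      have "m XOR n < 2 ^ k" "m XOR n = 0 \<longleftrightarrow> m = n"
        using mn by (auto simp: xor_less_power2) (metis xor_cancel(1) xor.left_neutral)
      then show ?thesis
        unfolding diff[OF v(1) mn(1)] by (auto simp: v_def e_def e'_def)
    qed
    then have "Re (e / 2 - (if m = n then e' / 2 else 0)) \<in> \<int>" "Im (e / 2 - (if m = n then e' / 2 else 0)) \<in> \<int>"
      using \<open>?P v\<close> mn(1) by (auto simp: gauss_lattice_def)
    \<comment> \<open>For \<open>m\<close> different from \<open>n\<close> the coordinate is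
      \<open>e / 2\<close>, and for equal masks with phases of different parity it is
      \<open>(e - e') / 2\<close> with one unit real and the other imaginary. Either way a real or
      imaginary part is 1/2 or -1/2, which is not an integer.\<close>
    then show "m = n \<and> even s = even t"
      using unit_square_cases[OF e(1)] unit_square_cases[OF e(2)] half_not_Ints
      by (auto split: if_splits)
  next
    assume mn: "m = n \<and> even s = even t"
    have "?P v" if v: "v \<in> carrier_vec (2 ^ k)" "v + v \<in> gauss_lattice (2 ^ k)" for v
    proof -
      have "Re ((M *\<^sub>v v - N *\<^sub>v v) $ r) \<in> \<int> \<and> Im ((M *\<^sub>v v - N *\<^sub>v v) $ r) \<in> \<int>" if r: "r < 2 ^ k" for r
      proof -
        define e where "e = M $$ (r, r XOR m)"
        define z where "z = v $ (r XOR m)"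
        have rm: "r XOR m < 2 ^ k"
          using r xor_monomialD(4)[OF M] by (rule xor_less_power2)
        have e: "e\<^sup>2 = (-1) ^ s"
          unfolding e_def by (rule xor_monomial_entry[OF M r])
        have "(N $$ (r, r XOR m))\<^sup>2 = e\<^sup>2"
          using xor_monomial_entry[OF N r] mn e by (simp add: minus_one_power_iff)
        then have "N $$ (r, r XOR m) = e \<or> N $$ (r, r XOR m) = - e"
          by (simp only: power2_eq_iff)
        then have "(M *\<^sub>v v - N *\<^sub>v v) $ r = 0 \<or> (M *\<^sub>v v - N *\<^sub>v v) $ r = e * (z + z)"
          unfolding diff[OF v(1) r] using mn by (auto simp: e_def z_def algebra_simps)
        moreover have "Re (z + z) \<in> \<int>" "Im (z + z) \<in> \<int>"
          using v rm by (auto simp: gauss_lattice_def z_def)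
        ultimately show ?thesis
          using unit_mult_gauss[OF e, of "z + z"] by auto
      qed
      then show ?thesis
        using v(1) mult_mat_vec_carrier[OF xor_monomialD(1)[OF M] v(1)]
          mult_mat_vec_carrier[OF xor_monomialD(1)[OF N] v(1)]
        by (simp add: gauss_lattice_def)
    qed
    then show "\<forall>x\<in>J2 k. torus_act k M x = torus_act k N x"
      unfolding J2_eq using act by blast
  qed
qed

section \<open>Switch permutations\<close>

text \<open>The shift by one passes between the labels 1 to \<open>2 ^ k\<close> of the permuted
  points and the bit patterns from 0 to \<open>2 ^ k - 1\<close>. Points outside are fixed, as they
  are by \<open>switch_perm\<close>.\<close>

definition xor_perm :: "nat \<Rightarrow> nat \<Rightarrow> nat \<Rightarrow> nat" where
  "xor_perm k m x = (if x \<in> {1..2 ^ k} then Suc ((x - 1) XOR m) else x)"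

lemma xor_perm_mem:
  assumes "m < 2 ^ k" "x \<in> {1..2 ^ k}"
  shows "xor_perm k m x \<in> {1..2 ^ k}"
proof -
  have "x - 1 < 2 ^ k"
    using assms(2) by (cases x) auto
  from xor_less_power2[OF this assms(1)] assms(2) show ?thesis
    by (simp add: xor_perm_def Suc_le_eq)
qed

lemma xor_perm_comp:
  assumes "n < 2 ^ k"
  shows "xor_perm k m \<circ> xor_perm k n = xor_perm k (m XOR n)"
proof
  fix x
  show "(xor_perm k m \<circ> xor_perm k n) x = xor_perm k (m XOR n) x"
  proof (cases "x \<in> {1..2 ^ k}")
    case True
    have n: "xor_perm k n x = Suc ((x - 1) XOR n)"
      using True by (simp add: xor_perm_def)
    have "(xor_perm k m \<circ> xor_perm k n) x = Suc ((xor_perm k n x - 1) XOR m)"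
      by (simp only: comp_apply xor_perm_def[of k m "xor_perm k n x"] xor_perm_mem[OF assms True] if_True)
    also have "\<dots> = xor_perm k (m XOR n) x"
      unfolding n using True by (simp add: xor_perm_def ac_simps)
    finally show ?thesis .
  qed (auto simp: xor_perm_def)
qed

lemma xor_perm_zero: "xor_perm k 0 = id"
  by (auto simp: xor_perm_def)

lemma xor_perm_inj:
  assumes "xor_perm k m = xor_perm k n"
  shows "m = n"
proof -
  \<comment> \<open>The point 1 carries the zero bit pattern, so its image is
    \<open>Suc m\<close>.\<close>
  have "xor_perm k m 1 = xor_perm k n 1"
    using assms by simp
  then show ?thesis
    by (simp add: xor_perm_def)
qed

lemma switch_perm_eq_xor_perm: "switch_perm k j = xor_perm k (2 ^ j)"
proof
  fix x
  \<comment> \<open>Subtraction is truncated; an odd block number guarantees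
    \<open>2 ^ j \<le> x - 1\<close>, so it is exact here.\<close>
  have "Suc ((x - 1) - 2 ^ j) = x - 2 ^ j" if "odd ((x - 1) div 2 ^ j)"
  proof -
    have "2 ^ j \<le> x - 1"
      using that by (intro leI notI) simp
    moreover have "(1 :: nat) \<le> 2 ^ j"
      by simp
    ultimately show ?thesis
      by linarith
  qed
  then show "switch_perm k j x = xor_perm k (2 ^ j) x"
    by (auto simp: switch_perm_def xor_perm_def xor_power2)
qed

text \<open>The factor with index \<open>l\<close> decides bit \<open>l - 1\<close>, so choosing the
  first \<open>j\<close> factors is writing a number below \<open>2 ^ j\<close> in binary. Stopping
  at an arbitrary \<open>j \<le> k\<close> makes the claim inductive, with the range of the
  permutations kept at \<open>2 ^ k\<close>.\<close>

lemma switch_products: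
  assumes "j \<le> k"
  shows "{fold (\<circ>) (map S [1..<Suc j]) id | S. \<forall>l\<in>{1..j}. S l \<in> {id, switch_perm k (l - 1)}} =
    xor_perm k ` {..<2 ^ j}"
  using assms
proof (induction j)
  case 0
  then show ?case
    by (auto simp: xor_perm_zero lessThan_Suc)
next
  case (Suc j)
  let ?A = "\<lambda>j. {fold (\<circ>) (map S [1..<Suc j]) id | S. \<forall>l\<in>{1..j}. S l \<in> {id, switch_perm k (l - 1)}}"
  have j: "j < k" "(2 :: nat) ^ j < 2 ^ k"
    using Suc.prems by simp_all
  have IH: "?A j = xor_perm k ` {..<2 ^ j}"
    using j(1) by (intro Suc.IH) simp
  have less: "m < 2 ^ k" if "m < 2 ^ j" for m :: nat
    using that j(2) by (rule less_trans)
  have upt: "[Suc 0..<Suc (Suc j)] = [Suc 0..<Suc j] @ [Suc j]"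
    by simp
  show ?case
  proof (rule equalityI; rule subsetI)
    fix p assume "p \<in> ?A (Suc j)"
    then obtain S where S: "p = fold (\<circ>) (map S [1..<Suc (Suc j)]) id"
      "\<forall>l\<in>{1..Suc j}. S l \<in> {id, switch_perm k (l - 1)}"
      by blast
    have "fold (\<circ>) (map S [1..<Suc j]) id \<in> ?A j"
      by (intro CollectI exI[of _ S] conjI refl) (use S(2) in simp)
    then obtain m where m: "m < 2 ^ j" "fold (\<circ>) (map S [1..<Suc j]) id = xor_perm k m"
      unfolding IH by auto
    have "p = S (Suc j) \<circ> xor_perm k m"
      using S(1) m(2) by (simp add: upt del: upt_Suc)
    moreover have "S (Suc j) = xor_perm k 0 \<or> S (Suc j) = xor_perm k (2 ^ j)"
      using S(2) by (force simp: xor_perm_zero switch_perm_eq_xor_perm)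
    ultimately have "p = xor_perm k m \<or> p = xor_perm k (2 ^ j XOR m)"
      by (auto simp: xor_perm_comp[OF less[OF m(1)]])
    moreover have "m < 2 ^ Suc j" "2 ^ j XOR m < 2 ^ Suc j"
      using m(1) xor_less_power2[of "2 ^ j" "Suc j" m] by simp_all
    ultimately show "p \<in> xor_perm k ` {..<2 ^ Suc j}"
      by blast
  next
    fix p assume "p \<in> xor_perm k ` {..<2 ^ Suc j}"
    then obtain m where m: "p = xor_perm k m" "m < 2 ^ Suc j"
      by blast
    \<comment> \<open>\<open>n\<close> is \<open>m\<close> with bit \<open>j\<close> removed, and
      \<open>s\<close> below is the factor that restores this bit.\<close>
    define n where "n = (if m < 2 ^ j then m else m - 2 ^ j)"
    have n: "n < 2 ^ j"
      using m(2) by (auto simp: n_def)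
    define s where "s = (if m < 2 ^ j then id else switch_perm k j)"
    have "m = n XOR 2 ^ j" if "\<not> m < 2 ^ j"
      using that n add_power2_eq_xor[OF n] by (simp add: n_def)
    then have p: "p = s \<circ> xor_perm k n"
      using xor_perm_comp[OF less[OF n]] m(1)
      by (auto simp: s_def switch_perm_eq_xor_perm n_def ac_simps)
    have "xor_perm k n \<in> ?A j"
      unfolding IH using n by blast
    then obtain S where S: "xor_perm k n = fold (\<circ>) (map S [1..<Suc j]) id"
      "\<forall>l\<in>{1..j}. S l \<in> {id, switch_perm k (l - 1)}"
      by blast
    \<comment> \<open>The new choice at \<open>Suc j\<close> does not disturb the factors already
      chosen.\<close>
    have "map (S(Suc j := s)) [1..<Suc j] = map S [1..<Suc j]"
      by simp
    then have "p = fold (\<circ>) (map (S(Suc j := s)) [1..<Suc (Suc j)]) id"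
      by (simp add: p S(1) upt del: upt_Suc)
    moreover have "\<forall>l\<in>{1..Suc j}. (S(Suc j := s)) l \<in> {id, switch_perm k (l - 1)}"
      using S(2) by (auto simp: s_def le_Suc_eq)
    ultimately show "p \<in> ?A (Suc j)"
      by blast
  qed
qed

lemma cliff_alt_simps:
  "carrier (cliff_alt k) = xor_perm k ` {..<2 ^ k}"
  "f \<otimes>\<^bsub>cliff_alt k\<^esub> g = f \<circ> g"
  "\<one>\<^bsub>cliff_alt k\<^esub> = id"
  using switch_products[of k k] by (simp_all add: cliff_alt_def sym_group_def del: upt_Suc)

lemma group_cliff_alt: "group (cliff_alt k)"
proof (rule groupI)
  fix f assume "f \<in> carrier (cliff_alt k)"
  then obtain m where "f = xor_perm k m" "m < 2 ^ k"
    by (auto simp: cliff_alt_simps)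
  then show "\<exists>g\<in>carrier (cliff_alt k). g \<otimes>\<^bsub>cliff_alt k\<^esub> f = \<one>\<^bsub>cliff_alt k\<^esub>"
    \<comment> \<open>Every element is its own inverse because \<open>m XOR m = 0\<close>.\<close>
    by (intro bexI[of _ f]) (auto simp: cliff_alt_simps xor_perm_comp xor_perm_zero)
qed (auto simp: cliff_alt_simps xor_perm_comp xor_less_power2 comp_assoc
  intro!: image_eqI[of id _ 0] xor_perm_zero[symmetric])

section \<open>The isomorphisms\<close>

text \<open>A matrix determines its mask and the parity of \<open>t\<close>, but not
  \<open>t\<close> itself; the description is therefore stated for the reduced pair.\<close>

definition monomial_class :: "nat \<Rightarrow> complex mat \<Rightarrow> int \<times> (nat \<Rightarrow> nat)" where
  "monomial_class k M = (THE y. \<exists>t m. xor_monomial k t m M \<and> y = (int t mod 2, xor_perm k m))"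

lemma monomial_class_eq:
  assumes M: "xor_monomial k t m M"
  shows "monomial_class k M = (int t mod 2, xor_perm k m)"
  unfolding monomial_class_def
proof (rule the_equality)
  fix y assume "\<exists>t m. xor_monomial k t m M \<and> y = (int t mod 2, xor_perm k m)"
  then obtain s n where N: "xor_monomial k s n M" and y: "y = (int s mod 2, xor_perm k n)"
    by blast
  \<comment> \<open>The comparison criterion is applied to two descriptions of the same matrix
    \<open>M\<close>.\<close>
  have "m = n \<and> even t = even s"
    using xor_monomial_entry_sign_iff[OF M N] by simp
  then show "y = (int t mod 2, xor_perm k m)"
    unfolding y by (auto simp: mod2_eq_if)
qed (use M in blast)

text \<open>The right-hand side is also that of \<open>torus_act_eq_iff\<close> and of
  \<open>xor_monomial_entry_sign_iff\<close>. Hence both equivalence relations are the fibre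
  relation of the same invariant.\<close>

lemma monomial_class_eq_iff:
  assumes "xor_monomial k s m M" "xor_monomial k t n N"
  shows "monomial_class k M = monomial_class k N \<longleftrightarrow> m = n \<and> even s = even t"
  using assms by (auto simp: monomial_class_eq mod2_eq_if split: if_splits dest: xor_perm_inj)

lemma monomial_class_mult:
  assumes "xor_monomial k s m M" "xor_monomial k t n N"
  shows "monomial_class k (M * N) =
    monomial_class k M \<otimes>\<^bsub>integer_mod_group 2 \<times>\<times> cliff_alt k\<^esub> monomial_class k N"
  using xor_monomialD(4)[OF assms(2)]
  by (simp add: monomial_class_eq[OF xor_monomial_mult[OF assms]] monomial_class_eq[OF assms(1)]
      monomial_class_eq[OF assms(2)] cliff_alt_simps xor_perm_comp mod_add_eq)

lemma monomial_class_carrier: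
  assumes "xor_monomial k t m M"
  shows "monomial_class k M \<in> carrier (integer_mod_group 2 \<times>\<times> cliff_alt k)"
  using xor_monomialD(4)[OF assms]
  by (simp add: monomial_class_eq[OF assms] carrier_integer_mod_group cliff_alt_simps)

lemma monomial_class_one:
  "monomial_class k (1\<^sub>m (2 ^ k)) = \<one>\<^bsub>integer_mod_group 2 \<times>\<times> cliff_alt k\<^esub>"
  by (simp add: monomial_class_eq[OF xor_monomial_one] cliff_alt_simps xor_perm_zero)

lemma monomial_class_surj:
  assumes "k \<ge> 1"
  shows "(\<lambda>a. monomial_class k (rho k a)) ` carrier (Gamma_hat k) =
    carrier (integer_mod_group 2 \<times>\<times> cliff_alt k)"
proof (intro equalityI subsetI)
  fix y assume "y \<in> carrier (integer_mod_group 2 \<times>\<times> cliff_alt k)"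
  then obtain e m where y: "y = (e, xor_perm k m)" "0 \<le> e" "e < 2" "m < 2 ^ k"
    by (auto simp: carrier_integer_mod_group cliff_alt_simps)
  obtain w where w: "w \<in> lists {1..2 * k}" "word_mask w = m" "even (word_phase w) \<longleftrightarrow> e = 0"
    using word_phase_mask_surj[OF assms y(4), of "e = 0"] by blast
  have "monomial_class k (rho k (clifford_prod (2 * k) w)) = y"
    using w(2,3) y(2,3)
    by (auto simp: rho_clifford_prod[OF w(1)] monomial_class_eq[OF xor_monomial_rho_word[OF w(1)]] y(1) mod2_eq_if)
  moreover have "clifford_prod (2 * k) w \<in> carrier (Gamma_hat k)"
    using w(1) unfolding Gamma_hat_carrier by blast
  ultimately show "y \<in> (\<lambda>a. monomial_class k (rho k a)) ` carrier (Gamma_hat k)"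
    by blast
next
  fix y assume "y \<in> (\<lambda>a. monomial_class k (rho k a)) ` carrier (Gamma_hat k)"
  then show "y \<in> carrier (integer_mod_group 2 \<times>\<times> cliff_alt k)"
    using Gamma_hat_xor_monomial monomial_class_carrier by blast
qed

lemma torsion_rel_eq:
  "torsion_rel k = {(a, b). a \<in> carrier (Gamma_hat k) \<and> b \<in> carrier (Gamma_hat k) \<and>
     monomial_class k (rho k a) = monomial_class k (rho k b)}"
proof -
  have "(\<forall>v\<in>J2 k. torus_act k (rho k a) v = torus_act k (rho k b) v) \<longleftrightarrow>
      monomial_class k (rho k a) = monomial_class k (rho k b)"
    if "a \<in> carrier (Gamma_hat k)" "b \<in> carrier (Gamma_hat k)" for a b
  proof -
    obtain s m t n where "xor_monomial k s m (rho k a)" "xor_monomial k t n (rho k b)"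
      using Gamma_hat_xor_monomial \<open>a \<in> _\<close> \<open>b \<in> _\<close> by blast
    then show ?thesis
      by (simp only: torus_act_eq_iff monomial_class_eq_iff)
  qed
  then show ?thesis
    unfolding torsion_rel_def by blast
qed

lemma entry_sign_rel_eq:
  "entry_sign_rel k = {(M, N). M \<in> carrier (rho_Gamma_hat k) \<and> N \<in> carrier (rho_Gamma_hat k) \<and>
     monomial_class k M = monomial_class k N}"
proof -
  have "(\<forall>r<2 ^ k. \<forall>c<2 ^ k. N $$ (r, c) = M $$ (r, c) \<or> N $$ (r, c) = - M $$ (r, c)) \<longleftrightarrow>
      monomial_class k M = monomial_class k N"
    if M: "M \<in> carrier (rho_Gamma_hat k)" and N: "N \<in> carrier (rho_Gamma_hat k)" for M N
  proof -
    obtain s m t n where "xor_monomial k s m M" "xor_monomial k t n N"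
      using rho_Gamma_hat_xor_monomial M N by blast
    then show ?thesis
      by (simp only: xor_monomial_entry_sign_iff monomial_class_eq_iff)
  qed
  then show ?thesis
    unfolding entry_sign_rel_def by blast
qed

lemma Gamma_hat_one:
  "\<one>\<^bsub>Gamma_hat k\<^esub> \<in> carrier (Gamma_hat k)" "rho k \<one>\<^bsub>Gamma_hat k\<^esub> = 1\<^sub>m (2 ^ k)"
proof -
  have one: "\<one>\<^bsub>Gamma_hat k\<^esub> = clifford_prod (2 * k) []"
    by (simp add: Gamma_hat_def clifford_prod_def)
  show "\<one>\<^bsub>Gamma_hat k\<^esub> \<in> carrier (Gamma_hat k)"
    unfolding Gamma_hat_carrier one by blast
  show "rho k \<one>\<^bsub>Gamma_hat k\<^esub> = 1\<^sub>m (2 ^ k)"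
    unfolding one by (simp add: rho_clifford_prod rho_word_def)
qed

lemma rho_Gamma_hat_mult:
  "a \<in> carrier (Gamma_hat k) \<Longrightarrow> b \<in> carrier (Gamma_hat k) \<Longrightarrow>
    rho k (a \<otimes>\<^bsub>Gamma_hat k\<^esub> b) = rho k a * rho k b"
  using Gamma_hat_subset[of k] rho_mult[of a k b] by (auto simp: Gamma_hat_def)

lemma Gamma_hat_mod_iso:
  assumes "k \<ge> 1"
  shows "group (Gamma_hat_mod k)" "Gamma_hat_mod k \<cong> integer_mod_group 2 \<times>\<times> cliff_alt k"
proof -
  let ?G = "Gamma_hat k" and ?H = "integer_mod_group 2 \<times>\<times> cliff_alt k"
  let ?h = "\<lambda>a. monomial_class k (rho k a)"
  have hom: "?h \<in> hom ?G ?H"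
  proof (rule homI)
    fix a b assume a: "a \<in> carrier ?G" and b: "b \<in> carrier ?G"
    then obtain s m t n where "xor_monomial k s m (rho k a)" "xor_monomial k t n (rho k b)"
      using Gamma_hat_xor_monomial by blast
    then show "?h (a \<otimes>\<^bsub>?G\<^esub> b) = ?h a \<otimes>\<^bsub>?H\<^esub> ?h b"
      by (simp only: rho_Gamma_hat_mult[OF a b] monomial_class_mult)
  qed (use Gamma_hat_xor_monomial monomial_class_carrier in blast)
  have one: "?h \<one>\<^bsub>?G\<^esub> = \<one>\<^bsub>?H\<^esub>"
    by (simp only: Gamma_hat_one(2) monomial_class_one)
  show "group (Gamma_hat_mod k)" "Gamma_hat_mod k \<cong> ?H"
    unfolding Gamma_hat_mod_def
    using quotient_group_fibres[OF DirProd_group[OF group_integer_mod_group group_cliff_alt] hom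
      monomial_class_surj[OF assms] Gamma_hat_mult_closed Gamma_hat_one(1) one torsion_rel_eq] by blast+
qed

lemma rho_Gamma_hat_mod_iso:
  assumes "k \<ge> 1"
  shows "group (rho_Gamma_hat_mod k)" "rho_Gamma_hat_mod k \<cong> integer_mod_group 2 \<times>\<times> cliff_alt k"
proof -
  let ?R = "rho_Gamma_hat k" and ?H = "integer_mod_group 2 \<times>\<times> cliff_alt k"
  have hom: "monomial_class k \<in> hom ?R ?H"
  proof (rule homI)
    fix M N assume "M \<in> carrier ?R" "N \<in> carrier ?R"
    then obtain s m t n where "xor_monomial k s m M" "xor_monomial k t n N"
      using rho_Gamma_hat_xor_monomial by blast
    then show "monomial_class k (M \<otimes>\<^bsub>?R\<^esub> N) = monomial_class k M \<otimes>\<^bsub>?H\<^esub> monomial_class k N"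
      by (simp only: rho_Gamma_hat_def monoid.simps monomial_class_mult)
  qed (use rho_Gamma_hat_xor_monomial monomial_class_carrier in blast)
  have surj: "monomial_class k ` carrier ?R = carrier ?H"
    using monomial_class_surj[OF assms] by (simp add: rho_Gamma_hat_def image_image)
  have closed: "M \<otimes>\<^bsub>?R\<^esub> N \<in> carrier ?R" if "M \<in> carrier ?R" "N \<in> carrier ?R" for M N
    using that by (auto simp: rho_Gamma_hat_def Gamma_hat_mult_closed simp flip: rho_Gamma_hat_mult)
  have one: "\<one>\<^bsub>?R\<^esub> \<in> carrier ?R" "monomial_class k \<one>\<^bsub>?R\<^esub> = \<one>\<^bsub>?H\<^esub>"
    using Gamma_hat_one[of k] by (force simp: rho_Gamma_hat_def monomial_class_one)+
  show "group (rho_Gamma_hat_mod k)" "rho_Gamma_hat_mod k \<cong> ?H"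
    unfolding rho_Gamma_hat_mod_def
    using quotient_group_fibres[OF DirProd_group[OF group_integer_mod_group group_cliff_alt] hom surj
      closed one entry_sign_rel_eq] by blast+
qed

theorem proposition5p6:
  fixes k :: nat
  assumes "k \<ge> 1"
  shows "group (Gamma_hat_mod k)
       \<and> group (cliff_alt k)
       \<and> group (rho_Gamma_hat_mod k)
       \<and> Gamma_hat_mod k \<cong> integer_mod_group 2 \<times>\<times> cliff_alt k
       \<and> Gamma_hat_mod k \<cong> rho_Gamma_hat_mod k"
  \<comment> \<open>The second isomorphism goes through the product group; reversing the one that
    starts at \<open>rho_Gamma_hat_mod k\<close> uses that this quotient is a group.\<close>
  using Gamma_hat_mod_iso[OF assms] rho_Gamma_hat_mod_iso[OF assms] group_cliff_alt
  by (metis group.iso_sym iso_trans)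

end
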